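(* Fix an odd positive integer $t$ and let $n=mt$ with $m\ge2$ an integer. Then the ratio of the number of irreducible representations of $J_n=\mathbb{C}^{S_{n-1}}\#\mathbb{C}C_n$ of dimension $t$ with Frobenius-Schur indicator $+1$ to the total number of irreducible representations of $J_n$ of dimension $t$ converges to $0$ as $m\to\infty$.
   Context: Identify $\{1,\dots,n\}$ with $\mathbb{Z}/n\mathbb{Z}$ and $S_n$ with the bijections of $\mathbb{Z}/n\mathbb{Z}$ under composition (right-to-left). $S_{n-1}$ is the subgroup of those $x$ with $x(n)=n$; $a=(1\,2\,\cdots\,n)$; $C_n=\langle a\rangle$. Each product $xa^r$ ($x\in S_{n-1}$) factors uniquely as $xa^r=(x\rhd a^r)(x\lhd a^r)$ with $x\rhd a^r\in C_n$, $x\lhd a^r\in S_{n-1}$; explicitly $x\rhd a^r=a^{x(r)}$ and $x\lhd a^r=a^{-x(r)}xa^r$. $\lhd$ is a right action of $C_n$ on the set $S_{n-1}$; $F_x$ is the stabilizer of $x$. $J_n$ is the semisimple Hopf algebra over $\mathbb{C}$ with basis $p_y\#b$ ($y\in S_{n-1}$, $b\in C_n$), product $(p_y\#b)(p_z\#c)=\delta_{z,\,y\lhd b}\,p_y\#bc$, unit $\sum_y p_y\#1$, counit $\varepsilon(p_y\#b)=\delta_{y,1}$, coproduct $\Delta(p_y\#b)=\sum_{z}(p_{yz^{-1}}\#(z\rhd b))\otimes(p_z\#b)$, antipode $S(p_y\#b)=p_{(y\lhd b)^{-1}}\#(y\rhd b)^{-1}$. For an irreducible representation $V$ of $F_x$,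 the induced irreducible $J_n$-module is $\hat V=\mathbb{C}C_n\otimes_{\mathbb{C}F_x}V$ with $(p_y\#b)\cdot(c\otimes v)=\delta_{y\lhd(bc),x}\,(bc\otimes v)$; its dimension is $[C_n:F_x]$. The Frobenius-Schur indicator of a $J_n$-module with character $\chi$ is $\nu(\chi)=\chi(\sum\Lambda_1\Lambda_2)$, where $\Lambda$ is the two-sided integral of $J_n$ with $\varepsilon(\Lambda)=1$ and $\Delta(\Lambda)=\sum\Lambda_1\otimes\Lambda_2$. Counting convention: the irreducible representations of dimension $t$ are counted as pairs $(x,\rho)$ with $x\in S_{n-1}$, $F_x=\langle a^t\rangle$, and $\rho$ one of the $n/t$ irreducible representations of $F_x$; the indicator attached to $(x,\rho)$ is that of the $J_n$-module induced from $\rho$ via $x$. The ratio is considered for $m$ large enough that the total number is nonzero. *)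

theory Defs
  imports
    Complex_Main
    "HOL-Algebra.Sym_Groups"
    "HOL-Algebra.Generated_Groups"
    "Jordan_Normal_Form.Matrix"
    "Jordan_Normal_Form.VS_Connect"
begin

section \<open>The matched pair\<close>

text \<open>
  Everything lives in \<^term>\<open>sym_group n\<close>, the permutations of \<open>{1..n}\<close> under right-to-left
  composition. The elements of \<open>\<int>/n\<int>\<close> are represented by \<open>1, \<dots>, n\<close>, so \<open>n\<close> is the zero class.
\<close>

definition cyc :: "nat \<Rightarrow> nat \<Rightarrow> nat"
  where "cyc n = cycle_of_list [1..<Suc n]"

definition Cn :: "nat \<Rightarrow> (nat \<Rightarrow> nat) set"
  where "Cn n = generate (sym_group n) {cyc n}"

definition Sn1 :: "nat \<Rightarrow> (nat \<Rightarrow> nat) set"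
  where "Sn1 n = {x \<in> carrier (sym_group n). x n = n}"

text \<open>
  For \<open>b = a\<^sup>r\<close> the class of \<open>r\<close> is \<open>b n\<close>, so \<open>rhd n x b\<close> is \<open>a\<close> to the power \<open>x(r)\<close>;
  see \<open>rhd_pow\<close> and \<open>matched_pair_factorization\<close> below.
\<close>

definition rhd :: "nat \<Rightarrow> (nat \<Rightarrow> nat) \<Rightarrow> (nat \<Rightarrow> nat) \<Rightarrow> (nat \<Rightarrow> nat)"
  where "rhd n x b = cyc n ^^ x (b n)"

definition lhd :: "nat \<Rightarrow> (nat \<Rightarrow> nat) \<Rightarrow> (nat \<Rightarrow> nat) \<Rightarrow> (nat \<Rightarrow> nat)"
  where "lhd n x b = inv' (rhd n x b) \<circ> x \<circ> b"

definition stab :: "nat \<Rightarrow> (nat \<Rightarrow> nat) \<Rightarrow> (nat \<Rightarrow> nat) set"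
  where "stab n x = {b \<in> Cn n. lhd n x b = x}"

abbreviation stab_group :: "nat \<Rightarrow> (nat \<Rightarrow> nat) \<Rightarrow> (nat \<Rightarrow> nat) monoid"
  where "stab_group n x \<equiv> sym_group n \<lparr>carrier := stab n x\<rparr>"

section \<open>The bismash product \<open>J\<^sub>n\<close>\<close>

text \<open>
  The pair \<open>(y, b)\<close> stands for the basis element \<open>p\<^sub>y # b\<close>; an element of \<open>J\<^sub>n\<close> is its coefficient
  function, and an element of \<open>J\<^sub>n \<otimes> J\<^sub>n\<close> is a coefficient function on pairs of basis elements.
  Operations given on basis elements are extended (bi)linearly. The antipode does not enter the
  definition of the indicator.
\<close>

type_synonym J_idx = "(nat \<Rightarrow> nat) \<times> (nat \<Rightarrow> nat)"

definition J_basis :: "nat \<Rightarrow> J_idx set"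
  where "J_basis n = Sn1 n \<times> Cn n"

definition J_carrier :: "nat \<Rightarrow> (J_idx \<Rightarrow> complex) set"
  where "J_carrier n = {h. \<forall>u. u \<notin> J_basis n \<longrightarrow> h u = 0}"

fun J_mult_basis :: "nat \<Rightarrow> J_idx \<Rightarrow> J_idx \<Rightarrow> J_idx \<Rightarrow> complex"
  where "J_mult_basis n (y, b) (z, c) = (\<lambda>w. if z = lhd n y b \<and> w = (y, b \<circ> c) then 1 else 0)"

definition J_mult_tensor :: "nat \<Rightarrow> (J_idx \<times> J_idx \<Rightarrow> complex) \<Rightarrow> J_idx \<Rightarrow> complex"
  where "J_mult_tensor n T = (\<lambda>w. \<Sum>(u, v)\<in>J_basis n \<times> J_basis n. T (u, v) * J_mult_basis n u v w)"

definition J_mult :: "nat \<Rightarrow> (J_idx \<Rightarrow> complex) \<Rightarrow> (J_idx \<Rightarrow> complex) \<Rightarrow> J_idx \<Rightarrow> complex"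
  where "J_mult n h k = J_mult_tensor n (\<lambda>(u, v). h u * k v)"

definition J_counit :: "nat \<Rightarrow> (J_idx \<Rightarrow> complex) \<Rightarrow> complex"
  where "J_counit n h = (\<Sum>(y, b)\<in>J_basis n. h (y, b) * (if y = id then 1 else 0))"

fun J_comult_basis :: "nat \<Rightarrow> J_idx \<Rightarrow> J_idx \<times> J_idx \<Rightarrow> complex"
  where "J_comult_basis n (y, b) =
    (\<lambda>w. \<Sum>z\<in>Sn1 n. if w = ((y \<circ> inv' z, rhd n z b), (z, b)) then 1 else 0)"

definition J_comult :: "nat \<Rightarrow> (J_idx \<Rightarrow> complex) \<Rightarrow> J_idx \<times> J_idx \<Rightarrow> complex"
  where "J_comult n h = (\<lambda>w. \<Sum>u\<in>J_basis n. h u * J_comult_basis n u w)"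

definition is_normalized_integral :: "nat \<Rightarrow> (J_idx \<Rightarrow> complex) \<Rightarrow> bool"
  where "is_normalized_integral n \<Lambda> \<longleftrightarrow>
    \<Lambda> \<in> J_carrier n \<and>
    (\<forall>h\<in>J_carrier n. J_mult n h \<Lambda> = (\<lambda>u. J_counit n h * \<Lambda> u) \<and>
                     J_mult n \<Lambda> h = (\<lambda>u. J_counit n h * \<Lambda> u)) \<and>
    J_counit n \<Lambda> = 1"

text \<open>Existence and uniqueness are shown in \<open>ex1_normalized_integral\<close> below.\<close>

definition J_integral :: "nat \<Rightarrow> J_idx \<Rightarrow> complex"
  where "J_integral n = (THE \<Lambda>. is_normalized_integral n \<Lambda>)"

section \<open>Irreducible representations of a group\<close>

text \<open>
  A representation is given in coordinates as a pair \<open>(d, \<rho>)\<close>, acting on \<open>\<complex>\<^sup>d\<close>. Extensionality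
  of \<open>\<rho>\<close> outside the group makes it a function on the group only.
\<close>

type_synonym 'g mrep = "nat \<times> ('g \<Rightarrow> complex mat)"

fun matrix_rep :: "('g, 'm) monoid_scheme \<Rightarrow> 'g mrep \<Rightarrow> bool"
  where "matrix_rep G (d, \<rho>) \<longleftrightarrow>
    \<rho> \<in> extensional (carrier G) \<and>
    (\<forall>g\<in>carrier G. \<rho> g \<in> carrier_mat d d) \<and>
    \<rho> \<one>\<^bsub>G\<^esub> = 1\<^sub>m d \<and>
    (\<forall>g\<in>carrier G. \<forall>h\<in>carrier G. \<rho> (g \<otimes>\<^bsub>G\<^esub> h) = \<rho> g * \<rho> h)"

fun irreducible_rep :: "('g, 'm) monoid_scheme \<Rightarrow> 'g mrep \<Rightarrow> bool"
  where "irreducible_rep G (d, \<rho>) \<longleftrightarrow>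
    matrix_rep G (d, \<rho>) \<and> 0 < d \<and>
    (\<forall>W. subspace class_ring W (module_vec TYPE(complex) d) \<longrightarrow>
         (\<forall>g\<in>carrier G. \<forall>w\<in>W. \<rho> g *\<^sub>v w \<in> W) \<longrightarrow>
         W = {0\<^sub>v d} \<or> W = carrier_vec d)"

definition rep_iso :: "('g, 'm) monoid_scheme \<Rightarrow> ('g mrep \<times> 'g mrep) set"
  where "rep_iso G = {((d, \<rho>), (e, \<sigma>)).
    irreducible_rep G (d, \<rho>) \<and> irreducible_rep G (e, \<sigma>) \<and> d = e \<and>
    (\<exists>P\<in>carrier_mat d d. invertible_mat P \<and> (\<forall>g\<in>carrier G. P * \<rho> g = \<sigma> g * P))}"

text \<open>The set of isomorphism classes of irreducible complex representations.\<close>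

definition Irr :: "('g, 'm) monoid_scheme \<Rightarrow> 'g mrep set set"
  where "Irr G = {R. irreducible_rep G R} // rep_iso G"

section \<open>Induced modules and indicators\<close>

text \<open>
  \<open>\<complex>C\<^sub>n\<close> is free as a right \<open>\<complex>F\<^sub>x\<close>-module on any transversal of the left cosets \<open>c F\<^sub>x\<close>, so the
  tensor product \<open>\<complex>C\<^sub>n \<otimes> V\<close> over \<open>\<complex>F\<^sub>x\<close> has the basis \<open>c \<otimes> e\<^sub>j\<close>, with \<open>c\<close> in the transversal and
  \<open>e\<^sub>j\<close> in the standard basis of \<open>V = \<complex>\<^sup>d\<close>. Its elements are coefficient functions on the indices
  \<open>(c, j)\<close>. In these coordinates, with \<open>c'\<close> the representative of \<open>c F\<^sub>x\<close>, the pure tensor is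
  \<open>c \<otimes> v = c' \<otimes> \<rho>(c'\<^sup>-\<^sup>1 c) v\<close>.
\<close>

definition coset_rep :: "nat \<Rightarrow> (nat \<Rightarrow> nat) \<Rightarrow> (nat \<Rightarrow> nat) \<Rightarrow> (nat \<Rightarrow> nat)"
  where "coset_rep n x c = (SOME c'. c' \<in> c <#\<^bsub>sym_group n\<^esub> stab n x)"

definition ind_index :: "nat \<Rightarrow> (nat \<Rightarrow> nat) \<Rightarrow> nat \<Rightarrow> ((nat \<Rightarrow> nat) \<times> nat) set"
  where "ind_index n x d = (coset_rep n x ` Cn n) \<times> {..<d}"

fun pure_tensor :: "nat \<Rightarrow> (nat \<Rightarrow> nat) \<Rightarrow> (nat \<Rightarrow> nat) mrep \<Rightarrow> (nat \<Rightarrow> nat) \<Rightarrow> complex vec \<Rightarrow>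
    (nat \<Rightarrow> nat) \<times> nat \<Rightarrow> complex"
  where "pure_tensor n x (d, \<rho>) c v =
    (\<lambda>(c', i). if c' = coset_rep n x c \<and> i < d then (\<rho> (inv' c' \<circ> c) *\<^sub>v v) $ i else 0)"

text \<open>\<open>ind_action n x R (y, b) k\<close> is the image of the basis vector with index \<open>k\<close> under
  \<open>p\<^sub>y # b\<close>; see \<open>ind_action_pure_tensor\<close> below for its effect on an arbitrary \<open>c \<otimes> v\<close>.\<close>

fun ind_action :: "nat \<Rightarrow> (nat \<Rightarrow> nat) \<Rightarrow> (nat \<Rightarrow> nat) mrep \<Rightarrow> J_idx \<Rightarrow>
    (nat \<Rightarrow> nat) \<times> nat \<Rightarrow> (nat \<Rightarrow> nat) \<times> nat \<Rightarrow> complex"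
  where "ind_action n x R (y, b) (c, j) =
    (\<lambda>l. if lhd n y (b \<circ> c) = x then pure_tensor n x R (b \<circ> c) (unit_vec (fst R) j) l else 0)"

definition ind_char :: "nat \<Rightarrow> (nat \<Rightarrow> nat) \<Rightarrow> (nat \<Rightarrow> nat) mrep \<Rightarrow> (J_idx \<Rightarrow> complex) \<Rightarrow> complex"
  where "ind_char n x R h =
    (\<Sum>u\<in>J_basis n. h u * (\<Sum>k\<in>ind_index n x (fst R). ind_action n x R u k k))"

definition FS_indicator :: "nat \<Rightarrow> (nat \<Rightarrow> nat) \<Rightarrow> (nat \<Rightarrow> nat) mrep \<Rightarrow> complex"
  where "FS_indicator n x R = ind_char n x R (J_mult_tensor n (J_comult n (J_integral n)))"

section \<open>The counted irreducible representations\<close>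

text \<open>
  Irreducible \<open>J\<^sub>n\<close>-modules of dimension \<open>t\<close> are counted as pairs \<open>(x, V)\<close>, where \<open>F\<^sub>x\<close> is generated
  by \<open>a\<^sup>t\<close> (so that \<open>[C\<^sub>n : F\<^sub>x] = t\<close>) and \<open>V\<close> is an isomorphism class of irreducible representations
  of \<open>F\<^sub>x\<close>. The indicator does not depend on the representative of \<open>V\<close>, by \<open>FS_indicator_iso\<close> below.
\<close>

definition irreps_of_dim :: "nat \<Rightarrow> nat \<Rightarrow> ((nat \<Rightarrow> nat) \<times> (nat \<Rightarrow> nat) mrep set) set"
  where "irreps_of_dim n t = {(x, V). x \<in> Sn1 n \<and>
    stab n x = generate (sym_group n) {cyc n ^^ t} \<and> V \<in> Irr (stab_group n x)}"

definition irreps_of_dim_indicator_one ::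
    "nat \<Rightarrow> nat \<Rightarrow> ((nat \<Rightarrow> nat) \<times> (nat \<Rightarrow> nat) mrep set) set"
  where "irreps_of_dim_indicator_one n t =
    {(x, V) \<in> irreps_of_dim n t. \<exists>R\<in>V. FS_indicator n x R = 1}"

section \<open>Well-definedness\<close>

lemma cyc_permutes: "cyc n permutes {1..n}"
  using cycle_permutes[of "[1..<Suc n]"]
  by (simp only: cyc_def set_upt atLeastLessThanSuc_atLeastAtMost)

lemma cyc_carrier: "cyc n \<in> carrier (sym_group n)"
  by (simp only: sym_group_carrier cyc_permutes)

lemma cyc_pow_permutes: "(cyc n ^^ r) permutes {1..n}"
proof (induction r)
  case (Suc r)
  then show ?case unfolding funpow.simps by (rule permutes_compose[OF _ cyc_permutes])
qed (simp only: funpow.simps permutes_id)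

lemma cyc_pow_apply:
  assumes "1 \<le> k" "k \<le> n"
  shows "(cyc n ^^ r) k = (r + (k - 1)) mod n + 1"
proof -
  let ?cs = "[1..<Suc n]"
  have "map (cyc n ^^ r) ?cs ! (k - 1) = rotate r ?cs ! (k - 1)"
    unfolding cyc_def by (subst cyclic_rotation) auto
  moreover have "?cs ! (k - 1) = k" using assms by (subst nth_upt) auto
  moreover have "rotate r ?cs ! (k - 1) = ?cs ! ((r + (k - 1)) mod n)"
    using assms by (subst nth_rotate) (auto simp del: upt_Suc simp: add.commute)
  moreover have "?cs ! ((r + (k - 1)) mod n) = (r + (k - 1)) mod n + 1"
    using assms by (subst nth_upt) auto
  ultimately show ?thesis using assms by (simp del: upt_Suc)
qed

lemma cyc_pow_n:
  assumes "1 \<le> r" "r \<le> n"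
  shows "(cyc n ^^ r) n = r"
proof -
  have *: "r + (n - 1) = (r - 1) + n" using assms by simp
  have "(r + (n - 1)) mod n = r - 1" unfolding * using assms by (simp only: mod_add_self2) simp
  then show ?thesis using assms by (subst cyc_pow_apply) auto
qed

lemma cyc_pow_eq_iff:
  assumes "0 < n"
  shows "cyc n ^^ r = cyc n ^^ s \<longleftrightarrow> r mod n = s mod n"
proof
  assume "cyc n ^^ r = cyc n ^^ s"
  then have "(cyc n ^^ r) 1 = (cyc n ^^ s) 1" by simp
  then show "r mod n = s mod n" using assms by (simp add: cyc_pow_apply)
next
  assume *: "r mod n = s mod n"
  show "cyc n ^^ r = cyc n ^^ s"
  proof
    fix k
    show "(cyc n ^^ r) k = (cyc n ^^ s) k"
    proof (cases "k \<in> {1..n}")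
      case True
      have "(r + (k - 1)) mod n = (s + (k - 1)) mod n" by (rule mod_add_cong[OF * refl])
      with True show ?thesis by (simp add: cyc_pow_apply)
    next
      case False
      then show ?thesis using cyc_pow_permutes by (metis permutes_not_in)
    qed
  qed
qed

lemma Cn_eq: assumes "0 < n" shows "Cn n = range (\<lambda>r. cyc n ^^ r)"
proof
  have inv: "inv\<^bsub>sym_group n\<^esub> (cyc n) = cyc n ^^ (n - 1)"
  proof (rule group.inv_equality[OF sym_group_is_group])
    have "cyc n ^^ (n - 1) \<circ> cyc n = cyc n ^^ (n - 1 + 1)"
      by (simp only: funpow_add) simp
    also have "\<dots> = cyc n ^^ 0" using assms by (subst cyc_pow_eq_iff) auto
    finally show "cyc n ^^ (n - 1) \<otimes>\<^bsub>sym_group n\<^esub> cyc n = \<one>\<^bsub>sym_group n\<^esub>"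
      by (simp add: sym_group_mult sym_group_one)
  qed (simp_all only: sym_group_carrier cyc_pow_permutes cyc_permutes)
  have "b \<in> range (\<lambda>r. cyc n ^^ r)" if "b \<in> generate (sym_group n) {cyc n}" for b
    using that
  proof induction
    case one
    have "\<one>\<^bsub>sym_group n\<^esub> = cyc n ^^ 0" by (simp add: sym_group_one)
    then show ?case by blast
  next
    case (incl h)
    then have "h = cyc n ^^ 1" by simp
    then show ?case by blast
  next
    case (inv h)
    then show ?case using \<open>inv\<^bsub>sym_group n\<^esub> (cyc n) = _\<close> by simp
  next
    case (eng h1 h2)
    then obtain r s where "h1 = cyc n ^^ r" "h2 = cyc n ^^ s" by blast
    then have "h1 \<otimes>\<^bsub>sym_group n\<^esub> h2 = cyc n ^^ (r + s)"
      by (simp only: sym_group_mult funpow_add)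
    then show ?case by blast
  qed
  then show "Cn n \<subseteq> range (\<lambda>r. cyc n ^^ r)" by (auto simp: Cn_def)
  have "cyc n ^^ r \<in> Cn n" for r
  proof (induction r)
    case 0
    show ?case using generate.one[of "sym_group n" "{cyc n}"] by (simp add: Cn_def sym_group_one id_def)
  next
    case (Suc r)
    then have "cyc n \<circ> (cyc n ^^ r) \<in> Cn n"
      using generate.eng[OF generate.incl[of "cyc n" "{cyc n}" "sym_group n"]]
      unfolding Cn_def sym_group_mult by blast
    then show ?case by (simp only: funpow.simps)
  qed
  then show "range (\<lambda>r. cyc n ^^ r) \<subseteq> Cn n" by auto
qed

lemma Cn_permutes: "b \<in> Cn n \<Longrightarrow> b permutes {1..n}"
  using group.generate_incl[OF sym_group_is_group, of "{cyc n}" n] cyc_carrier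
  by (auto simp: Cn_def sym_group_carrier)

lemma Cn_id: "id \<in> Cn n"
  using generate.one[of "sym_group n" "{cyc n}"] by (simp add: Cn_def sym_group_one)

lemma Cn_comp: "b \<in> Cn n \<Longrightarrow> c \<in> Cn n \<Longrightarrow> b \<circ> c \<in> Cn n"
  using generate.eng[of b "sym_group n" "{cyc n}" c] by (simp add: Cn_def sym_group_mult)

lemma Cn_inv: assumes "b \<in> Cn n" shows "inv' b \<in> Cn n"
  using group.generate_m_inv_closed[OF sym_group_is_group, of "{cyc n}" n b] cyc_carrier assms
    Cn_permutes[OF assms]
  by (simp add: Cn_def sym_group_carrier)

lemma Sn1_iff: "x \<in> Sn1 n \<longleftrightarrow> x permutes {1..n} \<and> x n = n"
  by (simp add: Sn1_def sym_group_carrier)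

lemma Sn1_id: "id \<in> Sn1 n"
  by (simp add: Sn1_iff permutes_id)

lemma Sn1_comp: "x \<in> Sn1 n \<Longrightarrow> y \<in> Sn1 n \<Longrightarrow> x \<circ> y \<in> Sn1 n"
  by (auto simp: Sn1_iff intro: permutes_compose)

lemma Sn1_inv: "x \<in> Sn1 n \<Longrightarrow> inv' x \<in> Sn1 n"
  by (auto simp: Sn1_iff permutes_inv permutes_inv_eq)

lemma Sn1_Cn_int: assumes "0 < n" "b \<in> Cn n" "b n = n" shows "b = id"
proof -
  obtain r where r: "b = cyc n ^^ r" using assms Cn_eq by auto
  then have "b = cyc n ^^ (if r mod n = 0 then n else r mod n)"
    using assms by (auto simp: cyc_pow_eq_iff)
  moreover have "(cyc n ^^ (if r mod n = 0 then n else r mod n)) n = (if r mod n = 0 then n else r mod n)"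
    using assms by (intro cyc_pow_n) (auto intro: less_imp_le)
  ultimately have "r mod n = 0" using assms by (metis mod_less_divisor less_irrefl)
  then have "cyc n ^^ r = cyc n ^^ 0" using assms by (subst cyc_pow_eq_iff) auto
  then show ?thesis using r by simp
qed

lemma rhd_Cn: "0 < n \<Longrightarrow> rhd n x b \<in> Cn n"
  by (simp add: rhd_def Cn_eq)

lemma rhd_pow: "1 \<le> r \<Longrightarrow> r \<le> n \<Longrightarrow> rhd n x (cyc n ^^ r) = cyc n ^^ x r"
  by (simp add: rhd_def cyc_pow_n)

lemma rhd_lhd:
  assumes "0 < n" shows "rhd n x b \<circ> lhd n x b = x \<circ> b"
proof -
  have "rhd n x b \<circ> inv' (rhd n x b) = id"
    using Cn_permutes[OF rhd_Cn[OF assms]] permutes_inv_o(1) by blast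
  then show ?thesis by (metis lhd_def comp_assoc id_comp)
qed

lemma lhd_Sn1:
  assumes "0 < n" "x \<in> Sn1 n" "b \<in> Cn n" shows "lhd n x b \<in> Sn1 n"
proof -
  have xb: "x permutes {1..n}" "b permutes {1..n}" using assms Sn1_iff Cn_permutes by auto
  have c: "rhd n x b permutes {1..n}" using assms Cn_permutes rhd_Cn by blast
  have "b n \<in> {1..n}" using xb(2) assms(1) by (subst permutes_in_image) auto
  then have "x (b n) \<in> {1..n}" using xb(1) by (simp only: permutes_in_image)
  then have "rhd n x b n = x (b n)" by (auto simp: rhd_def cyc_pow_n)
  then have "lhd n x b n = n" using permutes_inv_eq[OF c] by (simp add: lhd_def)
  moreover have "lhd n x b permutes {1..n}" unfolding lhd_def
    by (intro permutes_compose permutes_inv c xb)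
  ultimately show ?thesis by (simp add: Sn1_iff)
qed

lemma factor_unique:
  assumes "0 < n" "c \<in> Cn n" "c' \<in> Cn n" "y \<in> Sn1 n" "y' \<in> Sn1 n" "c \<circ> y = c' \<circ> y'"
  shows "c = c' \<and> y = y'"
proof -
  have p: "c permutes {1..n}" "c' permutes {1..n}" using assms Cn_permutes by auto
  have "c n = c' n" using assms(4-6) by (metis comp_apply Sn1_iff)
  then have "(inv' c' \<circ> c) n = n" using permutes_inv_eq[OF p(2)] by simp
  then have "inv' c' \<circ> c = id" using assms by (intro Sn1_Cn_int) (auto intro: Cn_comp Cn_inv)
  then have "c = c'" using p by (metis comp_assoc comp_id id_comp permutes_inv_o(1))
  moreover from this have "y = y'" using assms(6) p by (metis comp_assoc id_comp permutes_inv_o(2))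
  ultimately show ?thesis by simp
qed

theorem matched_pair_factorization:
  assumes "0 < n" "x \<in> Sn1 n" "b \<in> Cn n"
  shows "rhd n x b \<in> Cn n" "lhd n x b \<in> Sn1 n" "x \<circ> b = rhd n x b \<circ> lhd n x b"
    and "\<And>c y. c \<in> Cn n \<Longrightarrow> y \<in> Sn1 n \<Longrightarrow> x \<circ> b = c \<circ> y \<Longrightarrow> c = rhd n x b \<and> y = lhd n x b"
proof -
  show 1: "rhd n x b \<in> Cn n" "lhd n x b \<in> Sn1 n" "x \<circ> b = rhd n x b \<circ> lhd n x b"
    using assms by (auto simp: rhd_Cn lhd_Sn1 rhd_lhd)
  fix c y assume "c \<in> Cn n" "y \<in> Sn1 n" "x \<circ> b = c \<circ> y"
  with 1 factor_unique[OF assms(1)] show "c = rhd n x b \<and> y = lhd n x b" by metis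
qed

lemma lhd_action:
  assumes "0 < n" "x \<in> Sn1 n" "b \<in> Cn n" "c \<in> Cn n"
  shows "lhd n x (b \<circ> c) = lhd n (lhd n x b) c"
proof -
  let ?y = "lhd n x b"
  have "x \<circ> (b \<circ> c) = (x \<circ> b) \<circ> c" by (simp add: comp_assoc)
  also have "\<dots> = rhd n x b \<circ> (?y \<circ> c)" using assms by (simp add: rhd_lhd flip: comp_assoc)
  also have "\<dots> = (rhd n x b \<circ> rhd n ?y c) \<circ> lhd n ?y c"
    using assms by (simp add: rhd_lhd comp_assoc)
  finally have "x \<circ> (b \<circ> c) = (rhd n x b \<circ> rhd n ?y c) \<circ> lhd n ?y c" .
  then show ?thesis
    using matched_pair_factorization(4)[of n x "b \<circ> c"] assms
    by (metis Cn_comp rhd_Cn lhd_Sn1)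
qed

lemma lhd_id: assumes "0 < n" "x \<in> Sn1 n" shows "lhd n x id = x"
  using matched_pair_factorization(4)[OF assms Cn_id, of id x] assms Cn_id by auto

lemma lhd_one: assumes "0 < n" "b \<in> Cn n" shows "lhd n id b = id"
  using matched_pair_factorization(4)[OF assms(1) Sn1_id assms(2), of b id] assms Sn1_id by auto

lemma stab_subgroup:
  assumes "0 < n" "x \<in> Sn1 n" shows "subgroup (stab n x) (sym_group n)"
proof
  show "stab n x \<subseteq> carrier (sym_group n)" by (auto simp: stab_def sym_group_carrier Cn_permutes simp del: One_nat_def)
  show "\<one>\<^bsub>sym_group n\<^esub> \<in> stab n x" by (simp add: stab_def sym_group_one Cn_id lhd_id assms)
  fix g assume g: "g \<in> stab n x"
  then have gp: "g permutes {1..n}" "g \<in> Cn n" by (auto simp: stab_def Cn_permutes simp del: One_nat_def)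
  have "lhd n x (inv' g) = lhd n (lhd n x g) (inv' g)" using g by (simp add: stab_def)
  also have "\<dots> = lhd n x (g \<circ> inv' g)" using assms gp by (simp add: lhd_action Cn_inv)
  also have "\<dots> = x" using gp assms by (simp add: permutes_inv_o lhd_id)
  finally show "inv\<^bsub>sym_group n\<^esub> g \<in> stab n x"
    using gp by (simp add: sym_group_carrier stab_def Cn_inv)
  fix h assume "h \<in> stab n x"
  with g show "g \<otimes>\<^bsub>sym_group n\<^esub> h \<in> stab n x"
    using assms by (auto simp: sym_group_mult stab_def Cn_comp lhd_action)
qed

lemma finite_J_basis: "finite (J_basis n)"
proof -
  have "J_basis n \<subseteq> {p. p permutes {1..n}} \<times> {p. p permutes {1..n}}"
    by (auto simp: J_basis_def Sn1_iff Cn_permutes simp del: One_nat_def)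
  then show ?thesis using finite_subset finite_permutations by (metis finite_SigmaI finite_atLeastAtMost)
qed

lemma finite_Cn: "finite (Cn n)"
  by (rule finite_subset[OF _ finite_permutations[of "{1..n}"]]) (auto simp: Cn_permutes simp del: One_nat_def)

lemma finite_Sn1: "finite (Sn1 n)"
  by (rule finite_subset[OF _ finite_permutations[of "{1..n}"]]) (auto simp: Sn1_iff simp del: One_nat_def)

lemma Cn_comp_eq_iff:
  assumes "b \<in> Cn n" shows "d = b \<circ> c \<longleftrightarrow> c = inv' b \<circ> d"
  using permutes_inv_o[OF Cn_permutes[OF assms]] by (metis comp_assoc id_comp)

lemma J_mult_apply:
  assumes "0 < n"
  shows "J_mult n h k (y, d) =
    (if (y, d) \<in> J_basis n then \<Sum>b\<in>Cn n. h (y, b) * k (lhd n y b, inv' b \<circ> d) else 0)"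
proof -
  have summand: "(\<Sum>v\<in>J_basis n. h (y', b) * k v * J_mult_basis n (y', b) v (y, d)) =
      (if y' = y then if (y, d) \<in> J_basis n then h (y, b) * k (lhd n y b, inv' b \<circ> d) else 0 else 0)"
    if y': "y' \<in> Sn1 n" and b: "b \<in> Cn n" for y' b
  proof -
    have "J_mult_basis n (y', b) v (y, d) =
        (if v = (lhd n y' b, inv' b \<circ> d) then if y' = y then 1 else 0 else 0)" for v
      using Cn_comp_eq_iff[OF b, of d "snd v"] by (cases v) auto
    then have "(\<Sum>v\<in>J_basis n. h (y', b) * k v * J_mult_basis n (y', b) v (y, d)) =
      (\<Sum>v\<in>J_basis n. if v = (lhd n y' b, inv' b \<circ> d) then
         (if y' = y then h (y', b) * k (lhd n y' b, inv' b \<circ> d) else 0) else 0)"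
      by (intro sum.cong) auto
    also have "\<dots> = (if (lhd n y' b, inv' b \<circ> d) \<in> J_basis n then
         (if y' = y then h (y', b) * k (lhd n y' b, inv' b \<circ> d) else 0) else 0)"
      by (subst sum.delta) (auto simp: finite_J_basis)
    also have "(lhd n y' b, inv' b \<circ> d) \<in> J_basis n \<longleftrightarrow> d \<in> Cn n"
      using Cn_comp_eq_iff[OF b, of d "inv' b \<circ> d"] lhd_Sn1[OF assms y' b] b
      by (auto simp: J_basis_def intro: Cn_comp Cn_inv) (metis Cn_comp)
    finally show ?thesis using y' by (auto simp: J_basis_def)
  qed
  have "J_mult n h k (y, d) =
      (\<Sum>u\<in>J_basis n. \<Sum>v\<in>J_basis n. h u * k v * J_mult_basis n u v (y, d))"
    by (simp add: J_mult_def J_mult_tensor_def sum.cartesian_product)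
  also have "\<dots> = (\<Sum>y'\<in>Sn1 n. \<Sum>b\<in>Cn n. \<Sum>v\<in>J_basis n. h (y', b) * k v * J_mult_basis n (y', b) v (y, d))"
    using sum.cartesian_product[of "\<lambda>y' b. \<Sum>v\<in>J_basis n. h (y', b) * k v * J_mult_basis n (y', b) v (y, d)"
        "Cn n" "Sn1 n"]
    by (simp add: J_basis_def[of n] case_prod_unfold)
  also have "\<dots> = (\<Sum>y'\<in>Sn1 n. \<Sum>b\<in>Cn n.
      (if y' = y then if (y, d) \<in> J_basis n then h (y, b) * k (lhd n y b, inv' b \<circ> d) else 0 else 0))"
    by (intro sum.cong refl summand)
  also have "\<dots> = (\<Sum>y'\<in>Sn1 n. if y' = y then
      (\<Sum>b\<in>Cn n. if (y, d) \<in> J_basis n then h (y, b) * k (lhd n y b, inv' b \<circ> d) else 0) else 0)"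
    by (intro sum.cong) auto
  also have "\<dots> = (if y \<in> Sn1 n then
      (\<Sum>b\<in>Cn n. if (y, d) \<in> J_basis n then h (y, b) * k (lhd n y b, inv' b \<circ> d) else 0) else 0)"
    by (subst sum.delta) (auto simp: finite_Sn1)
  also have "\<dots> = (if (y, d) \<in> J_basis n then
      \<Sum>b\<in>Cn n. h (y, b) * k (lhd n y b, inv' b \<circ> d) else 0)"
    by (auto simp: J_basis_def)
  finally show ?thesis .
qed

lemma J_counit_eq: "J_counit n h = (\<Sum>b\<in>Cn n. h (id, b))"
proof -
  have "J_counit n h = (\<Sum>y\<in>Sn1 n. \<Sum>b\<in>Cn n. h (y, b) * (if y = id then 1 else 0))"
    by (simp add: J_counit_def J_basis_def sum.cartesian_product)
  also have "\<dots> = (\<Sum>y\<in>Sn1 n. if y = id then (\<Sum>b\<in>Cn n. h (id, b)) else 0)"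
    by (intro sum.cong) auto
  finally show ?thesis by (simp add: finite_Sn1 Sn1_id)
qed

lemma is_normalized_integral_explicit:
  assumes "0 < n"
  shows "is_normalized_integral n
    (\<lambda>(y, b). if y = id \<and> b \<in> Cn n then 1 / of_nat (card (Cn n)) else 0)"
    (is "is_normalized_integral n ?L")
proof -
  let ?N = "of_nat (card (Cn n)) :: complex"
  have N: "?N \<noteq> 0" using finite_Cn Cn_id by (auto simp: card_eq_0_iff)
  have car: "?L \<in> J_carrier n" by (auto simp: J_carrier_def J_basis_def Sn1_id)
  have one: "J_counit n ?L = 1" using N by (simp add: J_counit_eq)
  have left: "J_mult n h ?L u = J_counit n h * ?L u" if "h \<in> J_carrier n" for h u
  proof (cases u)
    case (Pair y d)
    have lhd1: "lhd n y b = id \<longleftrightarrow> y = id" if yb: "y \<in> Sn1 n" "b \<in> Cn n" for b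
    proof
      assume "lhd n y b = id"
      then have "lhd n y (b \<circ> inv' b) = id"
        using assms yb by (simp add: lhd_action Cn_inv lhd_one)
      then show "y = id" using permutes_inv_o[OF Cn_permutes[OF yb(2)]] assms yb by (simp add: lhd_id)
    qed (use assms yb in \<open>simp add: lhd_one\<close>)
    show ?thesis
    proof (cases "(y, d) \<in> J_basis n")
      case True
      then have yd: "y \<in> Sn1 n" "d \<in> Cn n" by (auto simp: J_basis_def)
      have "J_mult n h ?L (y, d) = (\<Sum>b\<in>Cn n. h (y, b) * (if y = id then 1 / ?N else 0))"
        using True yd by (auto simp: J_mult_apply[OF assms] lhd1 Cn_comp Cn_inv intro!: sum.cong)
      also have "\<dots> = J_counit n h * ?L (y, d)"
        using yd by (auto simp: J_counit_eq sum_divide_distrib)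
      finally show ?thesis using Pair by simp
    next
      case False
      then show ?thesis using Pair Sn1_id by (auto simp: J_mult_apply[OF assms] J_basis_def)
    qed
  qed
  have right: "J_mult n ?L h u = J_counit n h * ?L u" if "h \<in> J_carrier n" for h u
  proof (cases u)
    case (Pair y d)
    show ?thesis
    proof (cases "(y, d) \<in> J_basis n \<and> y = id")
      case True
      then have yd: "y = id" "d \<in> Cn n" by (auto simp: J_basis_def)
      have "J_mult n ?L h (y, d) = (\<Sum>b\<in>Cn n. 1 / ?N * h (id, inv' b \<circ> d))"
        using True by (auto simp: J_mult_apply[OF assms] lhd_one[OF assms] intro!: sum.cong)
      also have "\<dots> = (\<Sum>b\<in>Cn n. 1 / ?N * h (id, b))"
      proof (rule sum.reindex_bij_witness[where i = "\<lambda>b. d \<circ> inv' b" and j = "\<lambda>b. inv' b \<circ> d"])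
        fix b assume b: "b \<in> Cn n"
        note p = permutes_inv_o[OF Cn_permutes[OF b]] permutes_inv_o[OF Cn_permutes[OF yd(2)]]
        have bij: "bij b" "bij d" "bij (inv' b)" "bij (inv' d)"
          using Cn_permutes b yd Cn_inv permutes_bij by blast+
        show "d \<circ> inv' (inv' b \<circ> d) = b" "inv' (d \<circ> inv' b) \<circ> d = b"
          using bij p by (simp_all add: o_inv_distrib inv_inv_eq comp_assoc) (simp_all flip: comp_assoc)
        show "inv' b \<circ> d \<in> Cn n" "d \<circ> inv' b \<in> Cn n" using b yd by (auto intro: Cn_comp Cn_inv)
      qed auto
      also have "\<dots> = J_counit n h * ?L (y, d)"
        using yd by (simp add: J_counit_eq sum_divide_distrib)
      finally show ?thesis using Pair by simp
    next
      case False
      then show ?thesis using Pair Sn1_id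
        by (auto simp: J_mult_apply[OF assms] J_basis_def)
    qed
  qed
  show ?thesis unfolding is_normalized_integral_def using car one left right by auto
qed

theorem ex1_normalized_integral:
  assumes "0 < n" shows "\<exists>!\<Lambda>. is_normalized_integral n \<Lambda>"
proof (rule ex_ex1I)
  show "\<exists>\<Lambda>. is_normalized_integral n \<Lambda>" using is_normalized_integral_explicit[OF assms] by blast
  fix L M assume "is_normalized_integral n L" "is_normalized_integral n M"
  then have "J_mult n L M = M" "J_mult n L M = L"
    unfolding is_normalized_integral_def by auto
  then show "L = M" by simp
qed

lemma invertible_mat_obtain:
  fixes P :: "complex mat"
  assumes "P \<in> carrier_mat d d" "invertible_mat P"
  obtains Q where "Q \<in> carrier_mat d d" "P * Q = 1\<^sub>m d" "Q * P = 1\<^sub>m d" "invertible_mat Q"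
proof -
  obtain Q where Q: "inverts_mat P Q" "inverts_mat Q P"
    using assms(2) by (auto simp: invertible_mat_def)
  have "dim_row Q = d" "dim_col Q = d"
    using Q assms(1) unfolding inverts_mat_def
    by (metis carrier_matD(2) index_mult_mat(3) index_one_mat(3),
        metis carrier_matD(1) index_mult_mat(3) index_one_mat(3))
  then have c: "Q \<in> carrier_mat d d" by auto
  have "P * Q = 1\<^sub>m d" "Q * P = 1\<^sub>m d"
    using Q c assms(1) by (simp_all only: inverts_mat_def carrier_matD)
  moreover have "invertible_mat Q"
    using Q c unfolding invertible_mat_def square_mat.simps by blast
  ultimately show ?thesis using that c by blast
qed

lemma equiv_rep_iso: "equiv {R. irreducible_rep G R} (rep_iso G)"
proof (rule equivI)
  show "rep_iso G \<subseteq> {R. irreducible_rep G R} \<times> {R. irreducible_rep G R}"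
    by (auto simp: rep_iso_def simp del: irreducible_rep.simps)
  show "refl_on {R. irreducible_rep G R} (rep_iso G)"
  proof (rule refl_onI, clarsimp simp del: irreducible_rep.simps)
    fix d and \<rho> :: "'a \<Rightarrow> complex mat" assume irr: "irreducible_rep G (d, \<rho>)"
    then have "\<forall>g\<in>carrier G. 1\<^sub>m d * \<rho> g = \<rho> g * 1\<^sub>m d" by auto
    moreover have "invertible_mat (1\<^sub>m d :: complex mat)"
      by (auto simp: invertible_mat_def inverts_mat_def intro!: exI[of _ "1\<^sub>m d"])
    ultimately show "((d, \<rho>), (d, \<rho>)) \<in> rep_iso G"
      using irr unfolding rep_iso_def by (auto simp del: irreducible_rep.simps intro!: bexI[of _ "1\<^sub>m d"])
  qed
  show "sym (rep_iso G)"
  proof (rule symI, clarsimp simp: rep_iso_def simp del: irreducible_rep.simps)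
    fix d and \<rho> \<sigma> :: "'a \<Rightarrow> complex mat" and P :: "complex mat"
    assume irr: "irreducible_rep G (d, \<rho>)" "irreducible_rep G (d, \<sigma>)"
      and P: "P \<in> carrier_mat d d" "invertible_mat P" and eq: "\<forall>g\<in>carrier G. P * \<rho> g = \<sigma> g * P"
    obtain Q where Q: "Q \<in> carrier_mat d d" "P * Q = 1\<^sub>m d" "Q * P = 1\<^sub>m d" "invertible_mat Q"
      using invertible_mat_obtain[OF P] .
    have "Q * \<sigma> g = \<rho> g * Q" if g: "g \<in> carrier G" for g
    proof -
      have c: "\<rho> g \<in> carrier_mat d d" "\<sigma> g \<in> carrier_mat d d" using irr g by auto
      have "Q * \<sigma> g = Q * \<sigma> g * (P * Q)" using Q c by simp
      also have "\<dots> = Q * (\<sigma> g * P) * Q" using Q P c by (simp add: assoc_mult_mat[of _ d d _ d _ d])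
      also have "\<dots> = Q * (P * \<rho> g) * Q" using eq g by simp
      also have "\<dots> = (Q * P) * \<rho> g * Q" by (simp only: assoc_mult_mat[OF Q(1) P(1) c(1)])
      finally show ?thesis unfolding Q(3) using c by simp
    qed
    then show "\<exists>P\<in>carrier_mat d d. invertible_mat P \<and> (\<forall>g\<in>carrier G. P * \<sigma> g = \<rho> g * P)"
      using Q by blast
  qed
  show "trans (rep_iso G)"
  proof (rule transI, clarsimp simp: rep_iso_def simp del: irreducible_rep.simps)
    fix d and \<rho> \<sigma> \<tau> :: "'a \<Rightarrow> complex mat" and P Q :: "complex mat"
    assume irr: "irreducible_rep G (d, \<rho>)" "irreducible_rep G (d, \<sigma>)" "irreducible_rep G (d, \<tau>)"
      and P: "P \<in> carrier_mat d d" "invertible_mat P" and eqP: "\<forall>g\<in>carrier G. P * \<rho> g = \<sigma> g * P"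
      and Q: "Q \<in> carrier_mat d d" "invertible_mat Q" and eqQ: "\<forall>g\<in>carrier G. Q * \<sigma> g = \<tau> g * Q"
    obtain P' where P': "P' \<in> carrier_mat d d" "P * P' = 1\<^sub>m d" "P' * P = 1\<^sub>m d"
      using invertible_mat_obtain[OF P] .
    obtain Q' where Q': "Q' \<in> carrier_mat d d" "Q * Q' = 1\<^sub>m d" "Q' * Q = 1\<^sub>m d"
      using invertible_mat_obtain[OF Q] .
    note c = P(1) Q(1) P'(1) Q'(1)
    have "Q * P * (P' * Q') = Q * (P * P') * Q'" "P' * Q' * (Q * P) = P' * (Q' * Q) * P"
      using c by (simp_all add: assoc_mult_mat[of _ d d _ d _ d])
    then have "inverts_mat (Q * P) (P' * Q')" "inverts_mat (P' * Q') (Q * P)"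
      using c P' Q' by (auto simp: inverts_mat_def)
    then have inv: "invertible_mat (Q * P)" using c by (auto simp: invertible_mat_def)
    have "Q * P * \<rho> g = \<tau> g * (Q * P)" if g: "g \<in> carrier G" for g
    proof -
      have d: "\<rho> g \<in> carrier_mat d d" "\<sigma> g \<in> carrier_mat d d" "\<tau> g \<in> carrier_mat d d"
        using irr g by auto
      have "Q * P * \<rho> g = Q * (P * \<rho> g)" using c d by (simp add: assoc_mult_mat[of _ d d _ d _ d])
      also have "\<dots> = Q * \<sigma> g * P" using eqP g c d by (simp add: assoc_mult_mat[of _ d d _ d _ d])
      also have "\<dots> = \<tau> g * (Q * P)" using eqQ g c d by (simp add: assoc_mult_mat[of _ d d _ d _ d])
      finally show ?thesis .
    qed
    with inv c show "\<exists>P\<in>carrier_mat d d. invertible_mat P \<and> (\<forall>g\<in>carrier G. P * \<rho> g = \<tau> g * P)"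
      by (intro bexI[of _ "Q * P"]) auto
  qed
qed

lemma stab_comp:
  assumes "0 < n" "x \<in> Sn1 n" "g \<in> stab n x" "h \<in> stab n x" shows "g \<circ> h \<in> stab n x"
  using subgroup.m_closed[OF stab_subgroup[OF assms(1,2)] assms(3,4)] by (simp add: sym_group_mult)

lemma stab_inv:
  assumes "0 < n" "x \<in> Sn1 n" "g \<in> stab n x" shows "inv' g \<in> stab n x"
proof -
  have "g \<in> carrier (sym_group n)" using assms(3) by (simp add: stab_def sym_group_carrier Cn_permutes del: One_nat_def)
  then show ?thesis using subgroup.m_inv_closed[OF stab_subgroup[OF assms(1,2)] assms(3)] by simp
qed

lemma stab_id: assumes "0 < n" "x \<in> Sn1 n" shows "id \<in> stab n x"
  using subgroup.one_closed[OF stab_subgroup[OF assms]] by (simp add: sym_group_one)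

lemma coset_rep_mem:
  assumes "0 < n" "x \<in> Sn1 n"
  obtains g where "g \<in> stab n x" "coset_rep n x c = c \<circ> g"
proof -
  have "c \<circ> id \<in> c <#\<^bsub>sym_group n\<^esub> stab n x"
    using stab_id[OF assms] unfolding l_coset_def sym_group_mult by blast
  then have "coset_rep n x c \<in> c <#\<^bsub>sym_group n\<^esub> stab n x"
    unfolding coset_rep_def by (rule someI[of "\<lambda>k. k \<in> c <#\<^bsub>sym_group n\<^esub> stab n x"])
  then show ?thesis using that by (auto simp: l_coset_def sym_group_mult)
qed

lemma coset_rep_cong:
  assumes "0 < n" "x \<in> Sn1 n" "g \<in> stab n x"
  shows "coset_rep n x (c \<circ> g) = coset_rep n x c"
proof -
  have gp: "g permutes {1..n}" using assms(3) by (auto simp: stab_def Cn_permutes simp del: One_nat_def)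
  have "(c \<circ> g) <#\<^bsub>sym_group n\<^esub> stab n x = c <#\<^bsub>sym_group n\<^esub> stab n x"
  proof (intro equalityI subsetI)
    fix k assume "k \<in> (c \<circ> g) <#\<^bsub>sym_group n\<^esub> stab n x"
    then obtain h where h: "h \<in> stab n x" "k = c \<circ> (g \<circ> h)"
      by (auto simp: l_coset_def sym_group_mult comp_assoc)
    then show "k \<in> c <#\<^bsub>sym_group n\<^esub> stab n x"
      using stab_comp[OF assms h(1)] by (auto simp: l_coset_def sym_group_mult)
  next
    fix k assume "k \<in> c <#\<^bsub>sym_group n\<^esub> stab n x"
    then obtain h where h: "h \<in> stab n x" "k = c \<circ> h"
      by (auto simp: l_coset_def sym_group_mult)
    have "g \<circ> (inv' g \<circ> h) = h" using permutes_inv_o(1)[OF gp] by (simp flip: comp_assoc)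
    then have "k = (c \<circ> g) \<circ> (inv' g \<circ> h)" using h by (simp add: comp_assoc)
    then show "k \<in> (c \<circ> g) <#\<^bsub>sym_group n\<^esub> stab n x"
      using stab_comp[OF assms(1,2) stab_inv[OF assms] h(1)] unfolding l_coset_def sym_group_mult by blast
  qed
  then show ?thesis by (simp add: coset_rep_def)
qed

lemma coset_rep_Cn:
  assumes "0 < n" "x \<in> Sn1 n" "c \<in> Cn n" shows "coset_rep n x c \<in> Cn n"
  using coset_rep_mem[OF assms(1,2), of c] assms(3) by (metis (no_types, lifting) Cn_comp mem_Collect_eq stab_def)

lemma coset_rep_quot:
  assumes "0 < n" "x \<in> Sn1 n" "c \<in> Cn n" shows "inv' (coset_rep n x c) \<circ> c \<in> stab n x"
proof -
  obtain g where g: "g \<in> stab n x" "coset_rep n x c = c \<circ> g" using coset_rep_mem[OF assms(1,2)] .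
  have gC: "g \<in> Cn n" using g by (simp add: stab_def)
  have p: "bij c" "bij g" using Cn_permutes gC assms(3) permutes_bij by blast+
  have "inv' (c \<circ> g) \<circ> c = inv' g \<circ> (inv' c \<circ> c)" using p by (simp add: o_inv_distrib comp_assoc)
  also have "\<dots> = inv' g" using permutes_inv_o(2)[OF Cn_permutes[OF assms(3)]] by simp
  finally show ?thesis using g stab_inv[OF assms(1,2)] by simp
qed

text \<open>The relation \<open>c g \<otimes> v = c \<otimes> \<rho>(g) v\<close> defining the tensor product over \<open>\<complex>F\<^sub>x\<close>.\<close>

theorem pure_tensor_balanced:
  assumes "0 < n" "x \<in> Sn1 n" "matrix_rep (stab_group n x) (d, \<rho>)"
    and "c \<in> Cn n" "g \<in> stab n x" "v \<in> carrier_vec d"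
  shows "pure_tensor n x (d, \<rho>) (c \<circ> g) v = pure_tensor n x (d, \<rho>) c (\<rho> g *\<^sub>v v)"
proof -
  let ?q = "inv' (coset_rep n x c) \<circ> c"
  have q: "?q \<in> stab n x" using coset_rep_quot assms by blast
  have "\<rho> (?q \<circ> g) = \<rho> ?q * \<rho> g" "\<rho> ?q \<in> carrier_mat d d" "\<rho> g \<in> carrier_mat d d"
    using assms(3,5) q by (auto simp: sym_group_mult)
  then have "\<rho> (?q \<circ> g) *\<^sub>v v = \<rho> ?q *\<^sub>v (\<rho> g *\<^sub>v v)" using assms(6) by simp
  then have "\<rho> (inv' (coset_rep n x c) \<circ> (c \<circ> g)) *\<^sub>v v = \<rho> ?q *\<^sub>v (\<rho> g *\<^sub>v v)"
    by (simp only: comp_assoc)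
  then show ?thesis unfolding pure_tensor.simps coset_rep_cong[OF assms(1,2,5)]
    by (intro ext) (auto split: prod.splits)
qed

text \<open>The module structure \<open>(p\<^sub>y # b) (c \<otimes> v) = \<delta> (b c \<otimes> v)\<close> with \<open>\<delta> = 1\<close> iff \<open>y \<lhd> b c = x\<close>.\<close>

theorem ind_action_pure_tensor:
  assumes "0 < n" "x \<in> Sn1 n" and rep: "matrix_rep (stab_group n x) (d, \<rho>)"
    and "(y, b) \<in> J_basis n" "c \<in> Cn n" "v \<in> carrier_vec d"
  shows "(\<Sum>k\<in>ind_index n x d. pure_tensor n x (d, \<rho>) c v k * ind_action n x (d, \<rho>) (y, b) k l) =
    (if lhd n y (b \<circ> c) = x then pure_tensor n x (d, \<rho>) (b \<circ> c) v l else 0)"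
proof -
  let ?c = "coset_rep n x c"
  let ?q = "inv' ?c \<circ> c"
  let ?w = "\<rho> ?q *\<^sub>v v"
  have yb: "y \<in> Sn1 n" "b \<in> Cn n" using assms(4) by (auto simp: J_basis_def)
  have q: "?q \<in> stab n x" using coset_rep_quot assms by blast
  have qC: "?q \<in> Cn n" using q by (simp add: stab_def)
  have cC: "?c \<in> Cn n" using coset_rep_Cn assms by blast
  have c: "c = ?c \<circ> ?q" using permutes_inv_o(1)[OF Cn_permutes[OF cC]] by (simp flip: comp_assoc)
  have bc: "b \<circ> c = (b \<circ> ?c) \<circ> ?q" by (subst c) (simp add: comp_assoc)
  have w: "?w \<in> carrier_vec d" using rep q assms(6) by auto
  have delta: "lhd n y (b \<circ> c) = x \<longleftrightarrow> lhd n y (b \<circ> ?c) = x"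
  proof
    have bc': "lhd n y (b \<circ> c) = lhd n (lhd n y (b \<circ> ?c)) ?q"
      unfolding bc by (intro lhd_action Cn_comp[OF yb(2) cC] qC assms(1) yb(1))
    show "lhd n y (b \<circ> c) = x" if "lhd n y (b \<circ> ?c) = x" using that bc' q by (simp add: stab_def)
    assume "lhd n y (b \<circ> c) = x"
    then have "lhd n (lhd n y (b \<circ> c)) (inv' ?q) = x"
      using stab_inv[OF assms(1,2) q] by (simp add: stab_def)
    moreover have "lhd n (lhd n y (b \<circ> c)) (inv' ?q) = lhd n y ((b \<circ> c) \<circ> inv' ?q)"
      using assms yb qC by (intro lhd_action[symmetric] Cn_comp[OF yb(2) assms(5)] Cn_inv[OF qC] assms(1) yb(1))
    moreover have "(b \<circ> c) \<circ> inv' ?q = b \<circ> ?c"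
      unfolding bc using permutes_inv_o(1)[OF Cn_permutes[OF qC]] by (simp only: comp_assoc comp_id)
    ultimately show "lhd n y (b \<circ> ?c) = x" by simp
  qed
  have mv: "(M *\<^sub>v w) $ i = (\<Sum>j<d. w $ j * M $$ (i, j))"
    if "M \<in> carrier_mat d d" "w \<in> carrier_vec d" "i < d" for M :: "complex mat" and w i
    using that by (auto simp: scalar_prod_def mult.commute atLeast0LessThan intro!: sum.cong)
  have expand: "(\<Sum>j<d. ?w $ j * pure_tensor n x (d, \<rho>) (b \<circ> ?c) (unit_vec d j) l) =
      pure_tensor n x (d, \<rho>) (b \<circ> ?c) ?w l"
  proof (cases l)
    case (Pair c' i)
    show ?thesis
    proof (cases "c' = coset_rep n x (b \<circ> ?c) \<and> i < d")
      case True
      let ?M = "\<rho> (inv' c' \<circ> (b \<circ> ?c))"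
      have M: "?M \<in> carrier_mat d d"
        using rep coset_rep_quot[OF assms(1,2), of "b \<circ> ?c"] True Cn_comp[OF yb(2) cC] by auto
      have "(\<Sum>j<d. ?w $ j * (?M *\<^sub>v unit_vec d j) $ i) = (\<Sum>j<d. ?w $ j * ?M $$ (i, j))"
        using M True by (intro sum.cong refl) auto
      also have "\<dots> = (?M *\<^sub>v ?w) $ i"
        using mv[OF M w] True by simp
      finally show ?thesis using True Pair by (simp add: comp_assoc)
    qed (use Pair in auto)
  qed
  have "(\<Sum>k\<in>ind_index n x d. pure_tensor n x (d, \<rho>) c v k * ind_action n x (d, \<rho>) (y, b) k l) =
      (\<Sum>c'\<in>coset_rep n x ` Cn n. \<Sum>j<d. pure_tensor n x (d, \<rho>) c v (c', j) *
         ind_action n x (d, \<rho>) (y, b) (c', j) l)"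
    unfolding ind_index_def sum.cartesian_product by (intro sum.cong refl) (simp only: case_prod_unfold prod.collapse)
  also have "\<dots> = (\<Sum>c'\<in>coset_rep n x ` Cn n. if c' = ?c then
      (\<Sum>j<d. ?w $ j * ind_action n x (d, \<rho>) (y, b) (?c, j) l) else 0)"
    by (intro sum.cong refl) (auto intro!: sum.cong)
  also have "\<dots> = (\<Sum>j<d. ?w $ j * ind_action n x (d, \<rho>) (y, b) (?c, j) l)"
    using assms(5) by (subst sum.delta) (auto simp: finite_Cn)
  also have "\<dots> = (if lhd n y (b \<circ> ?c) = x then pure_tensor n x (d, \<rho>) (b \<circ> ?c) ?w l else 0)"
    unfolding expand[symmetric] by (auto simp del: pure_tensor.simps)
  also have "pure_tensor n x (d, \<rho>) (b \<circ> ?c) ?w = pure_tensor n x (d, \<rho>) (b \<circ> c) v"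
    unfolding bc using assms(6) by (intro pure_tensor_balanced[symmetric] assms(1,2) rep q Cn_comp yb cC)
  finally show ?thesis unfolding delta .
qed

lemma trace_comm:
  fixes A B :: "complex mat"
  assumes "A \<in> carrier_mat d d" "B \<in> carrier_mat d d"
  shows "(\<Sum>i<d. (A * B) $$ (i, i)) = (\<Sum>i<d. (B * A) $$ (i, i))"
proof -
  have "(\<Sum>i<d. (A * B) $$ (i, i)) = (\<Sum>i<d. \<Sum>k<d. A $$ (i, k) * B $$ (k, i))"
    using assms by (auto simp: scalar_prod_def atLeast0LessThan intro!: sum.cong)
  also have "\<dots> = (\<Sum>k<d. \<Sum>i<d. B $$ (k, i) * A $$ (i, k))"
    by (subst sum.swap) (simp only: mult.commute)
  also have "\<dots> = (\<Sum>i<d. (B * A) $$ (i, i))"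
    using assms by (auto simp: scalar_prod_def atLeast0LessThan intro!: sum.cong)
  finally show ?thesis .
qed

lemma ind_char_eq:
  assumes "0 < n" "x \<in> Sn1 n" and rep: "matrix_rep (stab_group n x) (d, \<rho>)"
  shows "ind_char n x (d, \<rho>) h =
    (\<Sum>(y, b)\<in>J_basis n. h (y, b) * (\<Sum>c\<in>coset_rep n x ` Cn n.
      if lhd n y (b \<circ> c) = x \<and> c = coset_rep n x (b \<circ> c)
      then \<Sum>j<d. \<rho> (inv' c \<circ> (b \<circ> c)) $$ (j, j) else 0))"
proof -
  have 1: "(\<Sum>k\<in>ind_index n x d. ind_action n x (d, \<rho>) (y, b) k k) =
    (\<Sum>c\<in>coset_rep n x ` Cn n.
      if lhd n y (b \<circ> c) = x \<and> c = coset_rep n x (b \<circ> c)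
      then \<Sum>j<d. \<rho> (inv' c \<circ> (b \<circ> c)) $$ (j, j) else 0)"
    if yb: "(y, b) \<in> J_basis n" for y b
  proof -
    have "(\<Sum>k\<in>ind_index n x d. ind_action n x (d, \<rho>) (y, b) k k) =
        (\<Sum>c\<in>coset_rep n x ` Cn n. \<Sum>j<d. ind_action n x (d, \<rho>) (y, b) (c, j) (c, j))"
      unfolding ind_index_def sum.cartesian_product
      by (intro sum.cong refl) (simp only: case_prod_unfold prod.collapse)
    also have "\<dots> = (\<Sum>c\<in>coset_rep n x ` Cn n.
      if lhd n y (b \<circ> c) = x \<and> c = coset_rep n x (b \<circ> c)
      then \<Sum>j<d. \<rho> (inv' c \<circ> (b \<circ> c)) $$ (j, j) else 0)"
    proof (intro sum.cong refl)
      fix c assume "c \<in> coset_rep n x ` Cn n"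
      then have bc: "b \<circ> c \<in> Cn n"
        using yb coset_rep_Cn[OF assms(1,2)] by (auto simp: J_basis_def intro!: Cn_comp)
      show "(\<Sum>j<d. ind_action n x (d, \<rho>) (y, b) (c, j) (c, j)) =
        (if lhd n y (b \<circ> c) = x \<and> c = coset_rep n x (b \<circ> c)
         then \<Sum>j<d. \<rho> (inv' c \<circ> (b \<circ> c)) $$ (j, j) else 0)"
      proof (cases "lhd n y (b \<circ> c) = x \<and> c = coset_rep n x (b \<circ> c)")
        case True
        then have "inv' c \<circ> (b \<circ> c) \<in> stab n x" using coset_rep_quot[OF assms(1,2) bc] by metis
        then have "\<rho> (inv' c \<circ> (b \<circ> c)) \<in> carrier_mat d d" using rep by auto
        then have "(\<rho> (inv' c \<circ> (b \<circ> c)) *\<^sub>v unit_vec d j) $ j = \<rho> (inv' c \<circ> (b \<circ> c)) $$ (j, j)"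
          if "j < d" for j using that by auto
        with True show ?thesis by (auto simp del: comp_apply intro!: sum.cong)
      qed auto
    qed
    finally show ?thesis .
  qed
  show ?thesis unfolding ind_char_def fst_conv case_prod_unfold
    by (intro sum.cong refl arg_cong2[where f = "(*)"]) (use 1 in \<open>auto simp only: prod.collapse fst_conv snd_conv split_paired_all\<close>)
qed

theorem FS_indicator_iso:
  assumes "0 < n" "x \<in> Sn1 n" "(R, R') \<in> rep_iso (stab_group n x)"
  shows "FS_indicator n x R = FS_indicator n x R'"
proof -
  let ?G = "stab_group n x"
  obtain d \<rho> \<sigma> P where R: "R = (d, \<rho>)" "R' = (d, \<sigma>)"
    and irr: "irreducible_rep ?G (d, \<rho>)" "irreducible_rep ?G (d, \<sigma>)"
    and P: "P \<in> carrier_mat d d" "invertible_mat P" and eq: "\<And>g. g \<in> stab n x \<Longrightarrow> P * \<rho> g = \<sigma> g * P"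
    using assms(3) unfolding rep_iso_def by (auto simp del: irreducible_rep.simps)
  obtain Q where Q: "Q \<in> carrier_mat d d" "P * Q = 1\<^sub>m d" "Q * P = 1\<^sub>m d"
    using invertible_mat_obtain[OF P] .
  have rep: "matrix_rep ?G (d, \<rho>)" "matrix_rep ?G (d, \<sigma>)" using irr by (auto simp del: matrix_rep.simps)
  have tr: "(\<Sum>j<d. \<rho> g $$ (j, j)) = (\<Sum>j<d. \<sigma> g $$ (j, j))" if g: "g \<in> stab n x" for g
  proof -
    have c: "\<rho> g \<in> carrier_mat d d" "\<sigma> g \<in> carrier_mat d d" using rep g by auto
    have "\<rho> g = Q * P * \<rho> g" unfolding Q(3) using c by simp
    also have "\<dots> = Q * (\<sigma> g * P)" unfolding assoc_mult_mat[OF Q(1) P(1) c(1)] eq[OF g] ..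
    finally have "(\<Sum>j<d. \<rho> g $$ (j, j)) = (\<Sum>j<d. (Q * (\<sigma> g * P)) $$ (j, j))" by simp
    also have "\<dots> = (\<Sum>j<d. (\<sigma> g * P * Q) $$ (j, j))" using c P Q by (intro trace_comm) auto
    also have "\<sigma> g * P * Q = \<sigma> g" unfolding assoc_mult_mat[OF c(2) P(1) Q(1)] Q(2) using c by simp
    finally show ?thesis .
  qed
  show ?thesis unfolding FS_indicator_def R ind_char_eq[OF assms(1,2) rep(1)] ind_char_eq[OF assms(1,2) rep(2)]
  proof (intro sum.cong refl, clarify, intro arg_cong2[where f = "(*)"] refl sum.cong)
    fix y b c assume "(y, b) \<in> J_basis n" "c \<in> coset_rep n x ` Cn n"
    then have bc: "b \<circ> c \<in> Cn n"
      using coset_rep_Cn[OF assms(1,2)] by (auto simp: J_basis_def intro!: Cn_comp)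
    have "inv' c \<circ> (b \<circ> c) \<in> stab n x" if "c = coset_rep n x (b \<circ> c)"
      using coset_rep_quot[OF assms(1,2) bc] that by metis
    then show "(if lhd n y (b \<circ> c) = x \<and> c = coset_rep n x (b \<circ> c)
        then \<Sum>j<d. \<rho> (inv' c \<circ> (b \<circ> c)) $$ (j, j) else 0) =
      (if lhd n y (b \<circ> c) = x \<and> c = coset_rep n x (b \<circ> c)
        then \<Sum>j<d. \<sigma> (inv' c \<circ> (b \<circ> c)) $$ (j, j) else 0)"
      using tr by presburger
  qed
qed

end

theory Submission
  imports Defs "HOL-Algebra.Multiplicative_Group" "HOL-Number_Theory.Totient"
    "Jordan_Normal_Form.Spectral_Radius"
begin

text \<open>
  If \<open>F\<^sub>x = \<langle>a\<^sup>t\<rangle>\<close> and the indicator attached to \<open>x\<close> is nonzero, the formula for the integral yields an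
  element \<open>y\<close> of the orbit of \<open>x\<close> such that \<open>y\<^sup>-\<^sup>1\<close> is in this orbit as well, and then \<open>x\<^sup>2\<close>
  centralizes \<open>a\<^sup>t\<close>. Multiplication by a unit \<open>v\<close> modulo \<open>n\<close> is an element of \<open>S\<^sub>n\<^sub>-\<^sub>1\<close> that normalizes
  \<open>C\<^sub>n\<close>, so the units act freely on \<open>{x. F\<^sub>x = \<langle>a\<^sup>t\<rangle>}\<close> by left composition. If \<open>x a\<^sup>t x\<^sup>-\<^sup>1 = a\<^sup>u\<^sup>t\<close>,
  then \<open>(v x)\<^sup>2\<close> centralizes \<open>a\<^sup>t\<close> only if \<open>(u v)\<^sup>2 \<equiv> 1\<close> modulo \<open>m\<close>, which leaves at most \<open>t s(m)\<close> of the
  \<open>\<phi>(n)\<close> units, where \<open>s(m)\<close> is the number of square roots of \<open>1\<close>. Hence the ratio is at most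
  \<open>t s(m) / \<phi>(m)\<close>, and \<open>s(m) / \<phi>(m) = O(m\<^sup>-\<^sup>1\<^sup>/\<^sup>2)\<close>. All \<open>x\<close> have the same finite number of representations
  \<open>\<rho>\<close>, because \<open>F\<^sub>x\<close> is always the same cyclic group.
\<close>

section \<open>Square roots of one modulo \<open>m\<close>\<close>

definition sqrts_of_one :: "nat \<Rightarrow> nat set"
  where "sqrts_of_one m = {w. w < m \<and> [w * w = 1] (mod m)}"

lemma finite_sqrts_of_one [simp]: "finite (sqrts_of_one m)"
  by (rule finite_subset[of _ "{..<m}"]) (auto simp: sqrts_of_one_def)

text \<open>Reduction modulo \<open>a\<close> and modulo \<open>b\<close> sends roots to pairs of
  roots, and it is injective by the Chinese remainder theorem.\<close>

lemma card_sqrts_of_one_mult_le: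
  assumes "coprime a b" "0 < a" "0 < b"
  shows "card (sqrts_of_one (a * b)) \<le> card (sqrts_of_one a) * card (sqrts_of_one b)"
proof -
  let ?f = "\<lambda>w. (w mod a, w mod b)"
  have "inj_on ?f (sqrts_of_one (a * b))"
  proof (rule inj_onI)
    fix v w assume vw: "v \<in> sqrts_of_one (a * b)" "w \<in> sqrts_of_one (a * b)" "?f v = ?f w"
    then have "[v = w] (mod a * b)"
      using assms(1) by (intro coprime_cong_mult_nat) (auto simp: cong_def)
    then show "v = w" using vw by (auto simp: sqrts_of_one_def cong_def)
  qed
  moreover have "?f ` sqrts_of_one (a * b) \<subseteq> sqrts_of_one a \<times> sqrts_of_one b"
  proof clarify
    fix w assume "w \<in> sqrts_of_one (a * b)"
    then have "[w * w = 1] (mod a * b)" by (simp add: sqrts_of_one_def)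
    then have "[w * w = 1] (mod a)" "[w * w = 1] (mod b)"
      by (metis cong_modulus_mult_nat, metis cong_modulus_mult_nat mult.commute)
    then show "w mod a \<in> sqrts_of_one a \<and> w mod b \<in> sqrts_of_one b"
      using assms by (simp add: sqrts_of_one_def cong_def mod_simps)
  qed
  ultimately have "card (sqrts_of_one (a * b)) \<le> card (sqrts_of_one a \<times> sqrts_of_one b)"
    by (intro card_inj_on_le) auto
  then show ?thesis by (simp add: card_cartesian_product)
qed

section \<open>Square roots of one modulo prime powers\<close>

lemma sqrts_of_one_dvd:
  assumes "w \<in> sqrts_of_one q" shows "int q dvd (int w - 1) * (int w + 1)"
proof -
  have "[w * w = 1] (mod q)" using assms by (simp add: sqrts_of_one_def)
  then have "[int (w * w) = int 1] (mod int q)" by (simp only: cong_int_iff)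
  then show ?thesis by (simp add: cong_iff_dvd_diff algebra_simps)
qed

text \<open>An odd prime cannot divide both \<open>w - 1\<close> and \<open>w + 1\<close>, which
  differ by 2, so the whole power \<open>p ^ k\<close> divides one of them.\<close>

lemma card_sqrts_of_one_odd_prime_power:
  assumes "prime p" "odd p" "0 < k"
  shows "card (sqrts_of_one (p ^ k)) \<le> 2"
proof -
  let ?q = "p ^ k"
  have q1: "1 < ?q" using assms prime_gt_1_nat by (metis one_less_power)
  have "sqrts_of_one ?q \<subseteq> {1, ?q - 1}"
  proof
    fix w assume w: "w \<in> sqrts_of_one ?q"
    then have lt: "w < ?q" by (simp add: sqrts_of_one_def)
    have dv: "int p ^ k dvd (int w - 1) * (int w + 1)" using sqrts_of_one_dvd[OF w] by simp
    have pr: "prime (int p)" using assms by simp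
    have "\<not> (int p dvd int w - 1 \<and> int p dvd int w + 1)"
    proof
      assume "int p dvd int w - 1 \<and> int p dvd int w + 1"
      then have "int p dvd (int w + 1) - (int w - 1)" using dvd_diff by blast
      then have "p dvd 2" using int_dvd_int_iff[of p 2] by simp
      then show False using assms by (metis primes_dvd_imp_eq two_is_prime_nat even_numeral)
    qed
    then have "coprime (int p ^ k) (int w - 1) \<or> coprime (int p ^ k) (int w + 1)"
      using pr by (meson coprime_power_left_iff prime_imp_coprime)
    then have "int ?q dvd int w + 1 \<or> int ?q dvd int w - 1"
      using dv by (metis coprime_dvd_mult_left_iff coprime_dvd_mult_right_iff of_nat_power)
    then show "w \<in> {1, ?q - 1}"
    proof
      assume "int ?q dvd int w + 1"
      then have "?q dvd w + 1" using int_dvd_int_iff[of ?q "w + 1"] by (simp add: add.commute)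
      then show ?thesis using lt by (auto dest: dvd_imp_le)
    next
      assume d: "int ?q dvd int w - 1"
      \<comment> \<open>The integer \<open>w - 1\<close> must agree with the truncated difference on
        \<open>nat\<close>.\<close>
      have "w \<noteq> 0"
      proof
        assume "w = 0"
        then have "?q dvd 1" using d int_dvd_int_iff[of ?q 1] by simp
        then show False using q1 by (metis less_irrefl nat_dvd_1_iff_1)
      qed
      then have "int ?q dvd int (w - 1)" using d by (simp add: of_nat_diff del: of_nat_power)
      then have "?q dvd w - 1" using int_dvd_int_iff by blast
      then show ?thesis using lt \<open>w \<noteq> 0\<close> by (auto dest: dvd_imp_le)
    qed
  qed
  then have "card (sqrts_of_one ?q) \<le> card {1, ?q - 1}" by (intro card_mono) auto
  also have "\<dots> \<le> 2" by (simp add: card_insert_if)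
  finally show ?thesis .
qed

text \<open>A root is odd, \<open>w = 2 j + 1\<close>, and \<open>2 h\<close> divides
  \<open>2 j (2 j + 2)\<close>. One of \<open>j\<close>, \<open>j + 1\<close> is odd, hence coprime
  to \<open>h = 2 ^ k\<close>, so \<open>h\<close> divides \<open>w - 1\<close> or
  \<open>w + 1\<close>; below \<open>2 h\<close> this leaves four candidates.\<close>

lemma card_sqrts_of_one_two_power: "card (sqrts_of_one (2 ^ Suc k)) \<le> 4"
proof -
  define h :: nat where "h = 2 ^ k"
  have h: "0 < h" by (simp add: h_def)
  have "sqrts_of_one (2 * h) \<subseteq> {1, h + 1, h - 1, 2 * h - 1}"
  proof
    fix w assume w: "w \<in> sqrts_of_one (2 * h)"
    then have lt: "w < 2 * h" by (simp add: sqrts_of_one_def)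
    have dv: "2 * int h dvd (int w - 1) * (int w + 1)" using sqrts_of_one_dvd[OF w] by simp
    then have "even ((int w - 1) * (int w + 1))" by (rule dvd_mult_left)
    then have "odd w" by auto
    then obtain j where j: "w = 2 * j + 1" by (elim oddE)
    have "2 * int h dvd 2 * (2 * int j * (int j + 1))" using dv j by (simp add: algebra_simps)
    then have "int h dvd 2 * int j * (int j + 1)" unfolding dvd_mult_cancel_left by simp
    then have "int h dvd int (2 * j * (j + 1))" by (simp add: algebra_simps)
    then have hd: "h dvd 2 * j * (j + 1)" using int_dvd_int_iff by blast
    consider "odd j" | "odd (j + 1)" by auto
    then have "h dvd 2 * j \<or> h dvd 2 * (j + 1)"
    proof cases
      case 1
      then have "coprime h j" by (simp add: h_def)
      moreover have "h dvd j * (2 * (j + 1))" using hd by (simp add: algebra_simps)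
      ultimately have "h dvd 2 * (j + 1)" by (simp only: coprime_dvd_mult_right_iff)
      then show ?thesis ..
    next
      case 2
      then have "coprime h (j + 1)" unfolding h_def by (metis coprime_left_2_iff_odd coprime_power_left_iff)
      then have "h dvd 2 * j" using hd by (simp only: coprime_dvd_mult_left_iff)
      then show ?thesis ..
    qed
    then show "w \<in> {1, h + 1, h - 1, 2 * h - 1}"
    proof
      assume "h dvd 2 * j"
      then obtain c where c: "2 * j = h * c" ..
      then have "h * c < h * 2" using lt j by linarith
      then have "c = 0 \<or> c = 1" by auto
      then show ?thesis using c j by auto
    next
      assume "h dvd 2 * (j + 1)"
      then obtain c where c: "2 * (j + 1) = h * c" ..
      then have "h * c = w + 1" using j by simp
      then have "h * c \<le> h * 2" using lt by linarith
      then have "c = 0 \<or> c = 1 \<or> c = 2" using h by auto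
      then show ?thesis using c j by auto
    qed
  qed
  then have "card (sqrts_of_one (2 * h)) \<le> card {1, h + 1, h - 1, 2 * h - 1}"
    by (intro card_mono) auto
  also have "\<dots> \<le> 4" by (simp add: card_insert_if)
  finally show ?thesis by (simp add: h_def)
qed

text \<open>\<open>weight p\<close> bounds \<open>s(p\<^sup>k)\<^sup>2 p\<^sup>k / \<phi>(p\<^sup>k)\<^sup>2\<close> for all \<open>k \<ge> 1\<close>; it can be \<open>1\<close> as soon as
  \<open>4 p \<le> (p - 1)\<^sup>2\<close>.\<close>

definition weight :: "nat \<Rightarrow> nat"
  where "weight p = (if p = 2 then 32 else if p = 3 then 3 else if p = 5 then 2 else 1)"

text \<open>Since \<open>\<phi>(p^(k+1)) = p^k (p - 1)\<close> and \<open>p^k \<le> (p^k)^2\<close>,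
  the case of the prime \<open>p\<close> itself implies the bound for all its powers.\<close>

lemma sqrts_of_one_prime_power_bound:
  assumes "prime p"
  shows "card (sqrts_of_one (p ^ Suc k)) ^ 2 * p ^ Suc k \<le> weight p * totient (p ^ Suc k) ^ 2"
proof -
  define s where "s = (if p = 2 then 4 else 2 :: nat)"
  have s: "card (sqrts_of_one (p ^ Suc k)) \<le> s"
  proof (cases "p = 2")
    case False
    then have "odd p" using assms primes_dvd_imp_eq two_is_prime_nat by blast
    then show ?thesis
      using False card_sqrts_of_one_odd_prime_power[OF assms, of "Suc k"] by (simp add: s_def)
  qed (use card_sqrts_of_one_two_power in \<open>simp add: s_def\<close>)
  \<comment> \<open>For 2, 3, 5 this reads \<open>32 \<le> 32\<close>, \<open>12 \<le> 12\<close>,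
    \<open>20 \<le> 32\<close>; from 7 on, \<open>4 p \<le> (p - 1)^2\<close> holds with weight
    1.\<close>
  have p2: "s ^ 2 * p \<le> weight p * (p - 1) ^ 2"
  proof (cases "p < 7")
    case True
    have "p \<ge> 2" using assms by (rule prime_ge_2_nat)
    then have "p = 2 \<or> p = 3 \<or> p = 4 \<or> p = 5 \<or> p = 6" using True by linarith
    moreover have "p \<noteq> 4" "p \<noteq> 6"
      using assms primes_dvd_imp_eq[OF two_is_prime_nat, of p] by auto
    ultimately show ?thesis by (auto simp: s_def weight_def)
  next
    case False
    then obtain j where "p = j + 7" by (metis add.commute le_add_diff_inverse not_less)
    then show ?thesis by (simp add: s_def weight_def power2_eq_square algebra_simps)
  qed
  have "card (sqrts_of_one (p ^ Suc k)) ^ 2 * p ^ Suc k \<le> s ^ 2 * p ^ Suc k"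
    using s by (intro mult_right_mono power_mono) auto
  also have "\<dots> = s ^ 2 * p * p ^ k" by simp
  also have "\<dots> \<le> weight p * (p - 1) ^ 2 * (p ^ k) ^ 2"
    using mult_mono[OF p2 self_le_power[of "p ^ k" 2]] prime_gt_0_nat[OF assms]
    by (simp add: Suc_le_eq)
  also have "\<dots> = weight p * totient (p ^ Suc k) ^ 2"
    unfolding totient_prime_power_Suc[OF assms] by (simp only: power_mult_distrib mult_ac)
  finally show ?thesis .
qed

text \<open>Induction that splits off the full power of one prime: root counts are submultiplicative
  and the totient is multiplicative on coprime factors, while the weight product gains one
  factor.\<close>

lemma sqrts_of_one_weighted_bound:
  assumes "0 < m"
  shows "card (sqrts_of_one m) ^ 2 * m \<le> (\<Prod>p\<in>prime_factors m. weight p) * totient m ^ 2"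
  using assms
proof (induction m rule: less_induct)
  case (less m)
  show ?case
  proof (cases "m = 1")
    case True
    \<comment> \<open>Modulo 1 the residue 0 is a square root of 1, so the count here is bounded by
      1 rather than 0.\<close>
    have "sqrts_of_one 1 \<subseteq> {0}" by (auto simp: sqrts_of_one_def)
    then have "card (sqrts_of_one 1) \<le> card {0 :: nat}" by (intro card_mono) auto
    then have "card (sqrts_of_one 1) ^ 2 \<le> 1 ^ 2" by (intro power_mono) auto
    then show ?thesis using True by simp
  next
    case False
    then obtain p where p: "prime p" "p dvd m" using prime_factor_nat by blast
    have "\<not> is_unit p" "m \<noteq> 0" using p less.prems by auto
    then obtain m' where m': "m = p ^ multiplicity p m * m'" "\<not> p dvd m'"
      using multiplicity_decompose' by metis
    have "multiplicity p m \<noteq> 0" using m' p(2) by (metis mult_1 power_0)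
    then obtain k where k: "multiplicity p m = Suc k" by (cases "multiplicity p m") auto
    let ?q = "p ^ Suc k"
    have m: "m = ?q * m'" using m' k by simp
    have pos: "0 < m'" "0 < ?q" using m less.prems p by (auto intro!: Nat.gr0I)
    have cop: "coprime ?q m'" using p m'(2) by (metis coprime_power_left_iff prime_imp_coprime)
    have "1 < ?q" using p(1) by (metis one_less_power prime_gt_1_nat zero_less_Suc)
    then have "m' < m" using m pos by simp
    then have IH: "card (sqrts_of_one m') ^ 2 * m' \<le> (\<Prod>p\<in>prime_factors m'. weight p) * totient m' ^ 2"
      using less.IH pos by blast
    have pf: "prime_factors m = insert p (prime_factors m')"
    proof -
      have "prime_factors ?q = {p}" by (simp only: prime_factorization_prime_power[OF p(1)]) simp
      moreover have "prime_factors m = prime_factors ?q \<union> prime_factors m'"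
        unfolding m using pos by (intro prime_factors_product) simp_all
      ultimately show ?thesis by simp
    qed
    have pn: "p \<notin> prime_factors m'" using m'(2) by auto
    have "card (sqrts_of_one m) ^ 2 * m \<le> (card (sqrts_of_one ?q) * card (sqrts_of_one m')) ^ 2 * (?q * m')"
      unfolding m using card_sqrts_of_one_mult_le[OF cop pos(2,1)]
      by (intro mult_right_mono power_mono) auto
    also have "\<dots> = (card (sqrts_of_one ?q) ^ 2 * ?q) * (card (sqrts_of_one m') ^ 2 * m')"
      by (simp add: power_mult_distrib mult_ac)
    also have "\<dots> \<le> (weight p * totient ?q ^ 2) * ((\<Prod>p\<in>prime_factors m'. weight p) * totient m' ^ 2)"
      by (intro mult_mono sqrts_of_one_prime_power_bound p IH) auto
    also have "\<dots> = (\<Prod>p\<in>prime_factors m. weight p) * totient m ^ 2"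
      unfolding pf using cop pn
      by (simp only: m totient_mult_coprime) (simp add: power_mult_distrib mult_ac del: power_Suc)
    finally show ?thesis .
  qed
qed

text \<open>All weights outside \<open>{2, 3, 5}\<close> are 1, so the product never exceeds
  \<open>32 * 3 * 2 = 192\<close>.\<close>

lemma sqrts_of_one_bound:
  assumes "0 < m"
  shows "card (sqrts_of_one m) ^ 2 * m \<le> 192 * totient m ^ 2"
proof -
  have "(\<Prod>p\<in>prime_factors m. weight p) = (\<Prod>p\<in>prime_factors m \<inter> {2, 3, 5}. weight p)"
    by (rule prod.mono_neutral_right) (auto simp: weight_def)
  also have "\<dots> \<le> (\<Prod>p\<in>{2, 3, 5}. weight p)"
    by (intro dvd_imp_le prod_dvd_prod_subset) (auto simp: weight_def)
  also have "\<dots> = 192" by (simp add: weight_def)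
  finally have "(\<Prod>p\<in>prime_factors m. weight p) * totient m ^ 2 \<le> 192 * totient m ^ 2"
    by (rule mult_right_mono) simp
  with sqrts_of_one_weighted_bound[OF assms] show ?thesis by (rule order_trans)
qed

lemma sqrts_of_one_totient_ratio:
  "(\<lambda>m. real (card (sqrts_of_one m)) / real (totient m)) \<longlonglongrightarrow> 0"
proof (rule tendsto_sandwich[of "\<lambda>_. 0"])
  have "(\<lambda>m. sqrt (192 * inverse (real m))) \<longlonglongrightarrow> sqrt (192 * 0)"
    by (intro tendsto_intros LIMSEQ_inverse_real_of_nat lim_inverse_n)
  then show "(\<lambda>m. sqrt (192 * inverse (real m))) \<longlonglongrightarrow> 0" by simp
  show "\<forall>\<^sub>F m in sequentially. real (card (sqrts_of_one m)) / real (totient m) \<le> sqrt (192 * inverse (real m))"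
  proof (rule eventually_sequentiallyI[of 1])
    fix m :: nat assume m: "1 \<le> m"
    have "real (card (sqrts_of_one m) ^ 2 * m) \<le> real (192 * totient m ^ 2)"
      using sqrts_of_one_bound[of m] m by (simp only: of_nat_le_iff)
    moreover have "0 < real (totient m)" using m by simp
    ultimately have "(real (card (sqrts_of_one m)) / real (totient m)) ^ 2 \<le> 192 * inverse (real m)"
      using m by (simp add: power_divide field_simps)
    then show "real (card (sqrts_of_one m)) / real (totient m) \<le> sqrt (192 * inverse (real m))"
      by (rule real_le_rsqrt)
  qed
qed auto

section \<open>Irreducible representations of a finite cyclic group\<close>

lemma one_dim_subspace:
  assumes "VectorSpace.subspace class_ring W (module_vec TYPE(complex) 1)"
  shows "W = {0\<^sub>v 1} \<or> W = carrier_vec 1"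
proof -
  interpret V: vec_space "TYPE(complex)" 1 .
  have sub: "W \<subseteq> carrier_vec 1" "0\<^sub>v 1 \<in> W" and smult: "\<And>c w. w \<in> W \<Longrightarrow> c \<cdot>\<^sub>v w \<in> W"
    using assms unfolding VectorSpace.subspace_def submodule_def by (auto simp: module_vec_simps class_ring_simps)
  show ?thesis
  proof (cases "W \<subseteq> {0\<^sub>v 1}")
    case False
    then obtain w where w: "w \<in> W" "w \<noteq> 0\<^sub>v 1" by auto
    then have wc: "w \<in> carrier_vec 1" using sub by auto
    then have w0: "w $ 0 \<noteq> 0" using w(2) by (auto simp: vec_eq_iff)
    have "v \<in> W" if "v \<in> carrier_vec 1" for v
    proof -
      have "v = (v $ 0 / w $ 0) \<cdot>\<^sub>v w" using that wc w0 by (intro eq_vecI) auto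
      then show ?thesis using smult[OF w(1)] by metis
    qed
    then show ?thesis using sub by blast
  qed (use sub in auto)
qed

text \<open>The witness is the trivial one-dimensional representation.\<close>

lemma ex_irreducible_rep: "\<exists>R. irreducible_rep G R" if "monoid G"
proof -
  let ?r = "restrict (\<lambda>g. 1\<^sub>m 1 :: complex mat) (carrier G)"
  have "irreducible_rep G (1, ?r)"
    using that one_dim_subspace monoid.one_closed[OF that] monoid.m_closed[OF that] by auto
  then show ?thesis by blast
qed

lemma line_subspace:
  assumes "v \<in> carrier_vec d"
  shows "VectorSpace.subspace class_ring (range (\<lambda>c. c \<cdot>\<^sub>v v)) (module_vec TYPE(complex) d)"
proof -
  interpret V: vec_space "TYPE(complex)" d .
  have add: "c \<cdot>\<^sub>v v + c' \<cdot>\<^sub>v v = (c + c') \<cdot>\<^sub>v v" "c \<cdot>\<^sub>v (c' \<cdot>\<^sub>v v) = (c * c') \<cdot>\<^sub>v v" for c c'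
    by (simp_all add: add_smult_distrib_vec smult_smult_assoc)
  have "0\<^sub>v d = 0 \<cdot>\<^sub>v v" using assms by (intro eq_vecI) auto
  then have z: "0\<^sub>v d \<in> range (\<lambda>c. c \<cdot>\<^sub>v v)" by blast
  show ?thesis unfolding VectorSpace.subspace_def submodule_def
    using assms z V.vectorspace_axioms V.module_axioms
    by (auto simp: module_vec_simps class_ring_simps add)
qed

text \<open>The line through a common eigenvector is invariant, hence the whole space; but no line
  contains both \<open>unit_vec d 0\<close> and \<open>unit_vec d 1\<close>.\<close>

lemma irreducible_rep_common_eigenvector:
  assumes "irreducible_rep G (d, \<rho>)" "v \<in> carrier_vec d" "v \<noteq> 0\<^sub>v d"
    and "\<And>g. g \<in> carrier G \<Longrightarrow> \<exists>l. \<rho> g *\<^sub>v v = l \<cdot>\<^sub>v v"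
  shows "d = 1"
proof (rule ccontr)
  let ?W = "range (\<lambda>c. c \<cdot>\<^sub>v v)"
  assume "d \<noteq> 1"
  then have d: "1 < d" using assms(1) by auto
  have "\<rho> g *\<^sub>v w \<in> ?W" if gw: "g \<in> carrier G" "w \<in> ?W" for g w
  proof -
    obtain c where c: "w = c \<cdot>\<^sub>v v" using gw(2) by blast
    obtain l where l: "\<rho> g *\<^sub>v v = l \<cdot>\<^sub>v v" using assms(4)[OF gw(1)] by blast
    have "\<rho> g \<in> carrier_mat d d" using assms(1) gw by auto
    then have "\<rho> g *\<^sub>v w = (c * l) \<cdot>\<^sub>v v"
      using c l assms(2) by (simp add: mult_mat_vec smult_smult_assoc)
    then show ?thesis by blast
  qed
  then have "?W = {0\<^sub>v d} \<or> ?W = carrier_vec d"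
    using assms(1) line_subspace[OF assms(2)] by simp
  moreover have "1 \<cdot>\<^sub>v v \<in> ?W" by blast
  ultimately have W: "?W = carrier_vec d" using assms(3) by auto
  have "unit_vec d 0 \<in> ?W" "unit_vec d 1 \<in> ?W" unfolding W by auto
  then obtain a b where ab: "unit_vec d 0 = a \<cdot>\<^sub>v v" "unit_vec d 1 = b \<cdot>\<^sub>v v" by blast
  have "(a \<cdot>\<^sub>v v) $ 0 = 1" "(a \<cdot>\<^sub>v v) $ 1 = 0" "(b \<cdot>\<^sub>v v) $ 1 = 1"
    unfolding ab[symmetric] using d by auto
  then show False using d assms(2) by auto
qed

lemma matrix_rep_nat_pow:
  assumes "monoid G" "matrix_rep G (d, \<rho>)" "g \<in> carrier G"
  shows "\<rho> (g [^]\<^bsub>G\<^esub> (k::nat)) = \<rho> g ^\<^sub>m k"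
  using assms by (induction k) (auto simp: monoid.nat_pow_closed)

text \<open>An eigenvector of the generator is one of all its powers, so the dimension is 1 and
  every value is an \<open>N\<close>-th root of unity. By extensionality only finitely many
  functions remain.\<close>

lemma finite_irreducible_reps_cyclic:
  assumes G: "monoid G" "finite (carrier G)" and g: "g \<in> carrier G"
    and gen: "carrier G = range (\<lambda>k::nat. g [^]\<^bsub>G\<^esub> k)"
    and N: "0 < N" "\<And>h. h \<in> carrier G \<Longrightarrow> h [^]\<^bsub>G\<^esub> (N::nat) = \<one>\<^bsub>G\<^esub>"
  shows "finite {R :: 'a mrep. irreducible_rep G R}"
proof -
  let ?M = "{mat 1 1 (\<lambda>_. z) |z :: complex. z ^ N = 1}"
  have "{R :: 'a mrep. irreducible_rep G R} \<subseteq> {1} \<times> (carrier G \<rightarrow>\<^sub>E ?M)"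
  proof clarify
    fix d and \<rho> :: "'a \<Rightarrow> complex mat" assume irr: "irreducible_rep G (d, \<rho>)"
    then have rep: "matrix_rep G (d, \<rho>)" and d: "0 < d" by auto
    have car: "\<rho> h \<in> carrier_mat d d" if "h \<in> carrier G" for h using rep that by simp
    obtain l where "eigenvalue (\<rho> g) l"
      using spectrum_non_empty[OF car[OF g] d] by (auto simp: spectrum_def)
    then obtain v where v: "eigenvector (\<rho> g) v l" by (auto simp: eigenvalue_def)
    have vd: "v \<in> carrier_vec d" "v \<noteq> 0\<^sub>v d" using v car[OF g] by (auto simp: eigenvector_def)
    have "\<exists>l. \<rho> h *\<^sub>v v = l \<cdot>\<^sub>v v" if h: "h \<in> carrier G" for h
    proof -
      obtain k :: nat where k: "h = g [^]\<^bsub>G\<^esub> k" using h unfolding gen by blast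
      have "\<rho> h *\<^sub>v v = l ^ k \<cdot>\<^sub>v v"
        unfolding k matrix_rep_nat_pow[OF G(1) rep g] by (rule eigenvector_pow[OF car[OF g] v])
      then show ?thesis ..
    qed
    then have d1: "d = 1" using irreducible_rep_common_eigenvector[OF irr vd] by blast
    have "\<rho> h \<in> ?M" if h: "h \<in> carrier G" for h
    proof -
      define z where "z = \<rho> h $$ (0, 0)"
      have eq: "\<rho> h = mat 1 1 (\<lambda>_. z)" using car[OF h] d1 by (intro eq_matI) (auto simp: z_def)
      have "\<rho> h ^\<^sub>m k = mat 1 1 (\<lambda>_. z ^ k)" for k
      proof (induction k)
        case 0
        show ?case using car[OF h] d1 by (intro eq_matI) auto
      next
        case (Suc k)
        have "\<rho> h ^\<^sub>m Suc k = mat 1 1 (\<lambda>_. z ^ k) * mat 1 1 (\<lambda>_. z)"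
          using Suc by (simp add: eq)
        also have "\<dots> = mat 1 1 (\<lambda>_. z ^ Suc k)"
          by (intro eq_matI) (auto simp: scalar_prod_def)
        finally show ?case .
      qed
      moreover have "\<rho> h ^\<^sub>m N = 1\<^sub>m 1"
        using matrix_rep_nat_pow[OF G(1) rep h, of N] N(2)[OF h] rep d1 by simp
      ultimately have "mat 1 1 (\<lambda>_. z ^ N) = 1\<^sub>m 1" by simp
      then have "mat 1 1 (\<lambda>_. z ^ N) $$ (0, 0) = (1\<^sub>m 1 :: complex mat) $$ (0, 0)" by simp
      then have "z ^ N = 1" by simp
      then show ?thesis using eq by blast
    qed
    then show "d \<in> {1} \<and> \<rho> \<in> carrier G \<rightarrow>\<^sub>E ?M"
      using rep d1 by (auto simp: PiE_def)
  qed
  moreover have "finite ?M"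
  proof -
    have "finite {z :: complex. z ^ N = 1}"
      using N(1) by (intro finite_roots_unity) simp
    then show ?thesis by simp
  qed
  ultimately show ?thesis using G(2) by (meson finite.emptyI finite.insertI finite_PiE finite_SigmaI finite_subset)
qed

text \<open>Positivity records finiteness and nonemptiness at once, since \<open>card\<close> of an
  infinite set is 0.\<close>

lemma card_Irr_cyclic_pos:
  assumes "monoid G" "finite (carrier G)" "g \<in> carrier G"
    and "carrier G = range (\<lambda>k::nat. g [^]\<^bsub>G\<^esub> k)"
    and "0 < N" "\<And>h. h \<in> carrier G \<Longrightarrow> h [^]\<^bsub>G\<^esub> (N::nat) = \<one>\<^bsub>G\<^esub>"
  shows "0 < card (Irr G)"
proof -
  have "finite (Irr G)"
    unfolding Irr_def quotient_def using finite_irreducible_reps_cyclic[OF assms] by simp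
  moreover obtain R where "irreducible_rep G R" using ex_irreducible_rep[OF assms(1)] by blast
  then have "Irr G \<noteq> {}" unfolding Irr_def quotient_def by blast
  ultimately show ?thesis by (simp add: card_gt_0_iff)
qed

section \<open>Permutations of residue classes\<close>

lemma Cn_commute:
  assumes "0 < n" "b \<in> Cn n" "c \<in> Cn n" shows "b \<circ> c = c \<circ> b"
proof -
  obtain r s where "b = cyc n ^^ r" "c = cyc n ^^ s" using assms Cn_eq by blast
  then show ?thesis by (simp add: add.commute flip: funpow_add)
qed

text \<open>Uniqueness of the factorization of \<open>x \<circ> b\<close> turns
  \<open>lhd n x b = x\<close> into the condition that conjugation by \<open>x\<close> keeps
  \<open>b\<close> in \<open>Cn n\<close>.\<close>

lemma mem_stab_iff:
  assumes "0 < n" "x \<in> Sn1 n"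
  shows "b \<in> stab n x \<longleftrightarrow> b \<in> Cn n \<and> (\<exists>c\<in>Cn n. x \<circ> b = c \<circ> x)"
proof
  assume "b \<in> stab n x"
  then have "b \<in> Cn n" "lhd n x b = x" by (auto simp: stab_def)
  then show "b \<in> Cn n \<and> (\<exists>c\<in>Cn n. x \<circ> b = c \<circ> x)"
    using rhd_lhd[OF assms(1), of x b] rhd_Cn[OF assms(1), of x b] by metis
next
  assume "b \<in> Cn n \<and> (\<exists>c\<in>Cn n. x \<circ> b = c \<circ> x)"
  then obtain c where "b \<in> Cn n" "c \<in> Cn n" "x \<circ> b = c \<circ> x" by blast
  then show "b \<in> stab n x"
    using matched_pair_factorization(4)[OF assms, of b c x] assms(2) by (simp add: stab_def)
qed

text \<open>Evaluation at \<open>n\<close>, the zero class, sends \<open>a^r\<close> to the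
  representative of \<open>r\<close> in \<open>{1..n}\<close>; this identifies points with residue
  classes.\<close>

lemma cyc_pow_n_eq_iff:
  assumes "0 < n" shows "(cyc n ^^ r) n = (cyc n ^^ s) n \<longleftrightarrow> [r = s] (mod n)"
proof -
  have "(cyc n ^^ k) n = (k + (n - 1)) mod n + 1" for k using assms by (intro cyc_pow_apply) auto
  then have "(cyc n ^^ r) n = (cyc n ^^ s) n \<longleftrightarrow> [r + (n - 1) = s + (n - 1)] (mod n)"
    by (simp only: cong_def add_right_cancel)
  also have "\<dots> \<longleftrightarrow> [r = s] (mod n)" by (rule cong_add_rcancel_nat)
  finally show ?thesis .
qed

lemma cyc_pow_n_in: "0 < n \<Longrightarrow> (cyc n ^^ r) n \<in> {1..n}"
  using permutes_in_image[OF cyc_pow_permutes, of r n n] by simp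

lemma cyc_pow_self: "i \<in> {1..n} \<Longrightarrow> (cyc n ^^ i) n = i"
  by (simp add: cyc_pow_n)

lemma generate_cyc_pow:
  assumes "0 < n" shows "generate (sym_group n) {cyc n ^^ t} = range (\<lambda>k. cyc n ^^ (t * k))"
proof -
  have G: "group (sym_group n)" by (rule sym_group_is_group)
  have pow: "(cyc n ^^ r) [^]\<^bsub>sym_group n\<^esub> (k::nat) = cyc n ^^ (r * k)" for r k
    by (induction k) (simp_all add: nat_pow_def sym_group_one sym_group_mult add.commute flip: funpow_add)
  have "finite (carrier (sym_group n))"
    by (rule finite_subset[OF _ finite_permutations[of "{1..n}"]]) (auto simp: sym_group_carrier)
  then have "generate (sym_group n) {cyc n ^^ t} = {(cyc n ^^ t) [^]\<^bsub>sym_group n\<^esub> k |k. k \<in> (UNIV :: nat set)}"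
    using G cyc_pow_permutes by (intro group.generate_pow_on_finite_carrier) (auto simp: sym_group_carrier)
  then show ?thesis by (auto simp: pow)
qed

text \<open>The permutation of \<open>{1..n}\<close> that represents the map \<open>f\<close> on residue classes modulo \<open>n\<close>.\<close>

definition residue_map :: "nat \<Rightarrow> (nat \<Rightarrow> nat) \<Rightarrow> nat \<Rightarrow> nat"
  where "residue_map n f i = (if i \<in> {1..n} then (cyc n ^^ f i) n else i)"

text \<open>The definition evaluates \<open>f\<close> at the representative in
  \<open>{1..n}\<close>; compatibility with congruence extends the formula to every
  exponent.\<close>

lemma residue_map_apply:
  assumes "0 < n" "\<And>r s. [r = s] (mod n) \<Longrightarrow> [f r = f s] (mod n)"
  shows "residue_map n f ((cyc n ^^ s) n) = (cyc n ^^ f s) n"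
proof -
  let ?i = "(cyc n ^^ s) n"
  have "[?i = s] (mod n)"
    using cyc_pow_self[OF cyc_pow_n_in[OF assms(1)]] cyc_pow_n_eq_iff[OF assms(1)] by blast
  then have "[f ?i = f s] (mod n)" by (rule assms(2))
  then show ?thesis
    using assms(1) cyc_pow_n_in[OF assms(1), of s] by (simp add: residue_map_def cyc_pow_n_eq_iff)
qed

lemma residue_map_permutes:
  assumes "0 < n" "\<And>r s. [f r = f s] (mod n) \<Longrightarrow> [r = s] (mod n)"
  shows "residue_map n f permutes {1..n}"
proof (rule bij_imp_permutes)
  have "inj_on (residue_map n f) {1..n}"
  proof (rule inj_onI)
    fix i j assume ij: "i \<in> {1..n}" "j \<in> {1..n}" "residue_map n f i = residue_map n f j"
    then have "[f i = f j] (mod n)" using assms(1) by (simp add: residue_map_def cyc_pow_n_eq_iff)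
    then have "[i = j] (mod n)" by (rule assms(2))
    then have "(cyc n ^^ i) n = (cyc n ^^ j) n" using assms(1) by (simp add: cyc_pow_n_eq_iff)
    then show "i = j" using ij cyc_pow_self by metis
  qed
  moreover have "residue_map n f ` {1..n} \<subseteq> {1..n}"
    using cyc_pow_n_in[OF assms(1)] by (auto simp: residue_map_def simp del: One_nat_def)
  ultimately show "bij_betw (residue_map n f) {1..n} {1..n}"
    by (simp add: bij_betw_def endo_inj_surj)
qed (simp add: residue_map_def del: atLeastAtMost_iff)

lemma residue_map_Sn1:
  assumes "0 < n" "\<And>r s. [f r = f s] (mod n) \<longleftrightarrow> [r = s] (mod n)" "[f 0 = 0] (mod n)"
  shows "residue_map n f \<in> Sn1 n"
proof -
  have "residue_map n f ((cyc n ^^ 0) n) = (cyc n ^^ 0) n"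
    using residue_map_apply[OF assms(1), of f 0] assms cyc_pow_n_eq_iff[OF assms(1), of "f 0" 0] by simp
  then show ?thesis
    using residue_map_permutes[OF assms(1), of f] assms(2) cyc_pow_n_eq_iff[OF assms(1)] by (simp add: Sn1_iff)
qed

text \<open>At the point of class \<open>i\<close> the two composites have the classes
  \<open>f (s + i)\<close> and \<open>g + f i\<close>; outside \<open>{1..n}\<close> all maps are
  the identity. Commutation with rotations thus becomes a family of congruences.\<close>

lemma residue_map_shift:
  assumes "0 < n" "\<And>r s. [f r = f s] (mod n) \<longleftrightarrow> [r = s] (mod n)"
  shows "residue_map n f \<circ> (cyc n ^^ s) = (cyc n ^^ g) \<circ> residue_map n f \<longleftrightarrow>
    (\<forall>i. [f (s + i) = g + f i] (mod n))" (is "?L \<longleftrightarrow> ?R")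
proof -
  have eq: "(residue_map n f \<circ> (cyc n ^^ s)) ((cyc n ^^ i) n) = (cyc n ^^ f (s + i)) n"
    "((cyc n ^^ g) \<circ> residue_map n f) ((cyc n ^^ i) n) = (cyc n ^^ (g + f i)) n" for i
    using residue_map_apply[OF assms(1), of f "s + i"] residue_map_apply[OF assms(1), of f i] assms(2)
    by (simp_all add: funpow_add)
  show ?thesis
  proof
    assume ?L
    then show ?R using eq by (metis cyc_pow_n_eq_iff[OF assms(1)])
  next
    assume R: ?R
    show ?L
    proof
      fix i
      show "(residue_map n f \<circ> (cyc n ^^ s)) i = ((cyc n ^^ g) \<circ> residue_map n f) i"
      proof (cases "i \<in> {1..n}")
        case True
        then show ?thesis using R eq[of i] by (simp add: cyc_pow_self cyc_pow_n_eq_iff[OF assms(1)])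
      next
        case False
        then have "(cyc n ^^ k) i = i" for k using permutes_not_in[OF cyc_pow_permutes] by blast
        with False show ?thesis by (simp add: residue_map_def del: atLeastAtMost_iff)
      qed
    qed
  qed
qed

section \<open>Existence of elements with stabilizer generated by \<open>a^t\<close>\<close>

definition orbit_type :: "nat \<Rightarrow> nat \<Rightarrow> (nat \<Rightarrow> nat) set"
  where "orbit_type n t = {x \<in> Sn1 n. stab n x = generate (sym_group n) {cyc n ^^ t}}"

text \<open>The witness adds \<open>t\<close> on the class of \<open>1\<close> modulo \<open>t\<close> and is the identity elsewhere; for \<open>t = 1\<close> it
  is the identity.\<close>

lemma orbit_type_nonempty:
  assumes "0 < t" "3 \<le> m" shows "orbit_type (m * t) t \<noteq> {}"
proof -
  let ?n = "m * t"
  define e where "e s = (if 1 < t \<and> s mod t = 1 then t else 0)" for s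
  define f where "f s = s + e s" for s
  have n: "0 < ?n" using assms by simp
  have dv: "t dvd ?n" by simp
  have et: "[e s = 0] (mod t)" for s by (simp add: e_def cong_def)
  have e_cong: "e r = e s" if "[r = s] (mod t)" for r s using that by (simp add: e_def cong_def)
  have f1: "[f r = f s] (mod ?n)" if "[r = s] (mod ?n)" for r s
    using cong_add[OF that, of "e r" "e s"] e_cong[OF cong_dvd_modulus_nat[OF that dv]] by (simp add: f_def)
  \<comment> \<open>Modulo \<open>t\<close> the correction \<open>e\<close> vanishes, so
    \<open>r\<close> and \<open>s\<close> agree modulo \<open>t\<close>; hence
    \<open>e r = e s\<close>, which cancels modulo \<open>m t\<close>.\<close>
  have f2: "[r = s] (mod ?n)" if "[f r = f s] (mod ?n)" for r s
  proof -
    have "[r + e r = s + e s] (mod t)" using cong_dvd_modulus_nat[OF that dv] by (simp add: f_def)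
    then have "[r = s] (mod t)" by (simp add: e_def cong_def split: if_splits)
    then show ?thesis using that e_cong[of r s] by (simp add: f_def cong_add_rcancel_nat)
  qed
  have f_iff: "[f r = f s] (mod ?n) \<longleftrightarrow> [r = s] (mod ?n)" for r s using f1 f2 by blast
  have f0: "f 0 = 0" by (simp add: f_def e_def)
  let ?x = "residue_map ?n f"
  have x: "?x \<in> Sn1 ?n" by (rule residue_map_Sn1[OF n f_iff]) (simp add: f0)
  \<comment> \<open>As \<open>f 0 = 0\<close>, the choice \<open>i = 0\<close> forces the rotation
    amount \<open>g\<close> to be \<open>f s\<close>.\<close>
  have shift: "cyc ?n ^^ s \<in> stab ?n ?x \<longleftrightarrow> (\<forall>i. [f (s + i) = f s + f i] (mod ?n))" for s
  proof -
    have "cyc ?n ^^ s \<in> stab ?n ?x \<longleftrightarrow> (\<exists>g. \<forall>i. [f (s + i) = g + f i] (mod ?n))"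
      unfolding mem_stab_iff[OF n x] using residue_map_shift[OF n f_iff] by (simp add: Cn_eq[OF n])
    also have "\<dots> \<longleftrightarrow> (\<forall>i. [f (s + i) = f s + f i] (mod ?n))"
    proof
      assume "\<exists>g. \<forall>i. [f (s + i) = g + f i] (mod ?n)"
      then obtain g where g: "\<And>i. [f (s + i) = g + f i] (mod ?n)" by blast
      have "[f s = g] (mod ?n)" using g[of 0] f0 by simp
      then show "\<forall>i. [f (s + i) = f s + f i] (mod ?n)"
        using cong_trans[OF g cong_add[OF cong_sym[OF \<open>[f s = g] (mod ?n)\<close>] cong_refl]] by blast
    qed blast
    finally show ?thesis .
  qed
  \<comment> \<open>This is where \<open>3 \<le> m\<close> enters: both \<open>t\<close> and
    \<open>2 t\<close> must be nonzero modulo \<open>m t\<close>.\<close>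
  have small: "\<not> [k * t = 0] (mod ?n)" if "0 < k" "k < 3" for k
  proof
    assume "[k * t = 0] (mod ?n)"
    then have "m * t dvd k * t" by (simp add: cong_0_iff)
    then have "m dvd k" using assms(1) by simp
    then show False using that assms(2) by (auto dest: dvd_imp_le)
  qed
  have "(\<forall>i. [f (s + i) = f s + f i] (mod ?n)) \<longleftrightarrow> t dvd s" for s
  proof
    assume "t dvd s"
    then have "e s = 0" "e (s + i) = e i" for i
      by (auto simp: e_def elim!: dvdE)
    then show "\<forall>i. [f (s + i) = f s + f i] (mod ?n)" by (simp add: f_def add.assoc)
  next
    assume *: "\<forall>i. [f (s + i) = f s + f i] (mod ?n)"
    have "[(s + i) + e (s + i) = (s + i) + (e s + e i)] (mod ?n)" for i
      using spec[OF *, of i] by (simp add: f_def algebra_simps)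
    then have E: "[e (s + i) = e s + e i] (mod ?n)" for i
      by (simp only: cong_add_lcancel_nat)
    show "t dvd s"
    proof (cases "t = 1")
      case False
      then have t: "1 < t" using assms(1) by simp
      show ?thesis
      proof (cases "s mod t = 1")
        case True
        \<comment> \<open>With \<open>i = s\<close>: the class of \<open>2 s\<close> modulo
          \<open>t\<close> is not that of 1, so \<open>e (s + s) = 0\<close>, whereas
          \<open>e s + e s = 2 t\<close> is nonzero modulo \<open>m t\<close>.\<close>
        have "(s + s) mod t = 2 mod t" using True by (metis mod_add_eq one_add_one)
        moreover have "2 mod t \<noteq> 1" using t by (cases "t = 2") auto
        ultimately have "e (s + s) = 0" by (simp add: e_def)
        moreover have "e s = t" using True t by (simp add: e_def)
        ultimately have "[t + t = 0] (mod ?n)" using cong_sym[OF E[of s]] by simp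
        then have "[2 * t = 0] (mod ?n)" by (simp only: mult_2)
        then show ?thesis using small[of 2] by simp
      next
        \<comment> \<open>With \<open>i = 1\<close>: \<open>e (s + 1)\<close> is congruent to
          \<open>t\<close>, hence nonzero, which puts \<open>s + 1\<close> in the class of 1 modulo
          \<open>t\<close>.\<close>
        case False
        then have "e s = 0" "e 1 = t" using t by (simp_all add: e_def)
        then have "[e (s + 1) = t] (mod ?n)" using E[of 1] by simp
        moreover have "\<not> [0 = t] (mod ?n)" using small[of 1] cong_sym[of 0 t ?n] by auto
        ultimately have "e (s + 1) \<noteq> 0" by metis
        then have "(s + 1) mod t = (0 + 1) mod t" using t by (simp add: e_def split: if_splits)
        then have "[s + 1 = 0 + 1] (mod t)" by (simp add: cong_def)
        then have "[s = 0] (mod t)" by (rule iffD1[OF cong_add_rcancel_nat])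
        then show ?thesis by (simp add: cong_0_iff)
      qed
    qed simp
  qed
  then have mem: "cyc ?n ^^ s \<in> stab ?n ?x \<longleftrightarrow> t dvd s" for s using shift by simp
  have "stab ?n ?x = range (\<lambda>k. cyc ?n ^^ (t * k))"
  proof (intro equalityI subsetI)
    fix b assume b: "b \<in> stab ?n ?x"
    then have "b \<in> Cn ?n" by (simp add: stab_def)
    then obtain s where s: "b = cyc ?n ^^ s" unfolding Cn_eq[OF n] by blast
    then obtain k where "s = t * k" using b mem by blast
    then show "b \<in> range (\<lambda>k. cyc ?n ^^ (t * k))" using s by blast
  next
    fix b assume "b \<in> range (\<lambda>k. cyc ?n ^^ (t * k))"
    then obtain k where "b = cyc ?n ^^ (t * k)" by blast
    then show "b \<in> stab ?n ?x" by (simp only: mem dvd_triv_left)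
  qed
  then have "?x \<in> orbit_type ?n t" using x by (simp add: orbit_type_def generate_cyc_pow[OF n])
  then show ?thesis by blast
qed

section \<open>The action of the units modulo \<open>n\<close>\<close>

lemma surj_comp_cancel: "surj h \<Longrightarrow> f \<circ> h = g \<circ> h \<Longrightarrow> f = g"
  by (rule surj_fun_eq) (auto dest: fun_cong)

lemma finite_orbit_type [simp]: "finite (orbit_type n t)"
  by (rule finite_subset[OF _ finite_Sn1[of n]]) (auto simp: orbit_type_def)

text \<open>If conjugation by \<open>x\<close> sends \<open>b\<close> into \<open>Cn n\<close>, then
  a further conjugation by \<open>p\<close>, which normalizes \<open>Cn n\<close>, keeps it
  there.\<close>

lemma stab_subset_normalizer_comp:
  assumes "0 < n" "p \<in> Sn1 n" "x \<in> Sn1 n"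
    and "\<And>s. \<exists>r. p \<circ> (cyc n ^^ s) = (cyc n ^^ r) \<circ> p"
  shows "stab n x \<subseteq> stab n (p \<circ> x)"
proof
  fix b assume "b \<in> stab n x"
  then obtain s where b: "b \<in> Cn n" "x \<circ> b = (cyc n ^^ s) \<circ> x"
    using mem_stab_iff[OF assms(1,3)] Cn_eq[OF assms(1)] by auto
  obtain r where "p \<circ> (cyc n ^^ s) = (cyc n ^^ r) \<circ> p" using assms(4) by blast
  then have "(p \<circ> x) \<circ> b = (cyc n ^^ r) \<circ> (p \<circ> x)" using b(2) by (metis comp_assoc)
  then show "b \<in> stab n (p \<circ> x)"
    using b(1) mem_stab_iff[OF assms(1) Sn1_comp[OF assms(2,3)]] Cn_eq[OF assms(1)] by blast
qed

text \<open>The inclusion of stabilizers, applied to \<open>p\<close> and then to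
  \<open>inv' p\<close>, gives equality.\<close>

lemma orbit_type_normalizer_comp:
  assumes "0 < n" "p \<in> Sn1 n" "x \<in> orbit_type n t"
    and "\<And>s. \<exists>r. p \<circ> (cyc n ^^ s) = (cyc n ^^ r) \<circ> p"
    and "\<And>s. \<exists>r. inv' p \<circ> (cyc n ^^ s) = (cyc n ^^ r) \<circ> inv' p"
  shows "p \<circ> x \<in> orbit_type n t"
proof -
  have x: "x \<in> Sn1 n" using assms(3) by (simp add: orbit_type_def)
  have "inv' p \<circ> p = id" using assms(2) Sn1_iff permutes_inv_o(2) by blast
  then have "inv' p \<circ> (p \<circ> x) = x" by (metis comp_assoc id_comp)
  then have "stab n (p \<circ> x) = stab n x"
    using stab_subset_normalizer_comp[OF assms(1,2) x assms(4)]
      stab_subset_normalizer_comp[OF assms(1) Sn1_inv[OF assms(2)] Sn1_comp[OF assms(2) x] assms(5)]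
    by auto
  then show ?thesis using assms(2,3) Sn1_comp by (simp add: orbit_type_def)
qed

section \<open>Multiplication by a unit modulo \<open>n\<close>\<close>

abbreviation mult_map :: "nat \<Rightarrow> nat \<Rightarrow> nat \<Rightarrow> nat"
  where "mult_map n v \<equiv> residue_map n (\<lambda>s. v * s)"

lemma mult_map_Sn1: "0 < n \<Longrightarrow> coprime v n \<Longrightarrow> mult_map n v \<in> Sn1 n"
  by (rule residue_map_Sn1) (simp_all add: cong_mult_lcancel_nat)

lemma mult_map_shift:
  assumes "0 < n" "coprime v n"
  shows "mult_map n v \<circ> (cyc n ^^ s) = (cyc n ^^ (v * s)) \<circ> mult_map n v"
  using residue_map_shift[OF assms(1), of "\<lambda>s. v * s" s "v * s"] assms(2)
  by (simp add: cong_mult_lcancel_nat distrib_left)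

lemma inv_mult_map_shift:
  assumes "0 < n" "coprime v n"
  shows "\<exists>r. inv' (mult_map n v) \<circ> (cyc n ^^ s) = (cyc n ^^ r) \<circ> inv' (mult_map n v)"
proof -
  let ?p = "mult_map n v"
  \<comment> \<open>With \<open>w\<close> inverse to \<open>v\<close> modulo \<open>n\<close>, the
    map carries \<open>a^(w s)\<close> to \<open>a^s\<close>, so its inverse carries
    \<open>a^s\<close> back to \<open>a^(w s)\<close>.\<close>
  obtain w where "[v * w = 1] (mod n)" using cong_solve_coprime_nat[OF assms(2)] by auto
  then have "[v * (w * s) = s] (mod n)" using cong_scalar_right[of "v * w" 1 n s] by (simp add: mult.assoc)
  then have "cyc n ^^ (v * (w * s)) = cyc n ^^ s" using assms(1) by (simp add: cyc_pow_eq_iff cong_def)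
  then have *: "?p \<circ> (cyc n ^^ (w * s)) = (cyc n ^^ s) \<circ> ?p" using mult_map_shift[OF assms] by simp
  have p: "?p \<circ> inv' ?p = id" "inv' ?p \<circ> ?p = id"
    using mult_map_Sn1[OF assms] Sn1_iff permutes_inv_o by blast+
  have "inv' ?p \<circ> (cyc n ^^ s) = inv' ?p \<circ> ((cyc n ^^ s) \<circ> ?p) \<circ> inv' ?p"
    using p(1) by (simp add: comp_assoc)
  also have "\<dots> = (inv' ?p \<circ> ?p) \<circ> (cyc n ^^ (w * s)) \<circ> inv' ?p"
    unfolding *[symmetric] by (simp only: comp_assoc)
  finally show ?thesis using p(2) by auto
qed

lemma mult_map_orbit_type:
  assumes "0 < n" "coprime v n" "x \<in> orbit_type n t"
  shows "mult_map n v \<circ> x \<in> orbit_type n t" "inv' (mult_map n v) \<circ> x \<in> orbit_type n t"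
proof -
  let ?p = "mult_map n v"
  have p: "?p \<in> Sn1 n" by (rule mult_map_Sn1[OF assms(1,2)])
  then have "inv' (inv' ?p) = ?p" using Sn1_iff permutes_inv_inv by blast
  then show "?p \<circ> x \<in> orbit_type n t" "inv' ?p \<circ> x \<in> orbit_type n t"
    using mult_map_shift[OF assms(1,2)] inv_mult_map_shift[OF assms(1,2)]
      orbit_type_normalizer_comp[OF assms(1) p assms(3)]
      orbit_type_normalizer_comp[OF assms(1) Sn1_inv[OF p] assms(3)] by (metis, metis)
qed

text \<open>Conjugation by \<open>x\<close> sends \<open>a^t\<close> to some \<open>a^r\<close>. The
  \<open>m\<close>-th power of \<open>a^t\<close> is the identity, so \<open>m t\<close> divides
  \<open>r m\<close>, and \<open>u = r / t\<close> is an integer.\<close>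

lemma orbit_type_multiplier:
  assumes "0 < m" "0 < t" "x \<in> orbit_type (m * t) t"
  obtains u where "\<And>k. x \<circ> (cyc (m * t) ^^ (t * k)) = (cyc (m * t) ^^ (t * (u * k))) \<circ> x"
proof -
  let ?a = "cyc (m * t)"
  have n: "0 < m * t" using assms by simp
  have x: "x \<in> Sn1 (m * t)" "stab (m * t) x = range (\<lambda>k. ?a ^^ (t * k))"
    using assms(3) by (auto simp: orbit_type_def generate_cyc_pow[OF n])
  then have "?a ^^ (t * 1) \<in> stab (m * t) x" by blast
  then obtain r where r: "x \<circ> (?a ^^ t) = (?a ^^ r) \<circ> x"
    using mem_stab_iff[OF n x(1)] Cn_eq[OF n] by auto
  have pow: "x \<circ> (?a ^^ (t * k)) = (?a ^^ (r * k)) \<circ> x" for k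
  proof (induction k)
    case (Suc k)
    have "x \<circ> (?a ^^ (t * Suc k)) = (x \<circ> (?a ^^ t)) \<circ> (?a ^^ (t * k))"
      by (simp add: funpow_add comp_assoc)
    also have "\<dots> = (?a ^^ r) \<circ> (x \<circ> (?a ^^ (t * k)))" unfolding r by (simp only: comp_assoc)
    also have "\<dots> = (?a ^^ (r * Suc k)) \<circ> x" unfolding Suc by (simp add: funpow_add comp_assoc)
    finally show ?case .
  qed simp
  have one: "?a ^^ (t * m) = id" using cyc_pow_eq_iff[OF n, of "t * m" 0] by (simp add: mult.commute)
  have xp: "x \<circ> inv' x = id" using x(1) Sn1_iff permutes_inv_o(1) by blast
  have "(?a ^^ (r * m)) \<circ> x = x" using pow[of m] one by simp
  then have "?a ^^ (r * m) = ?a ^^ 0" using xp by (metis comp_assoc comp_id funpow_0 id_apply ext)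
  then have "m * t dvd r * m" using cyc_pow_eq_iff[OF n, of "r * m" 0] by (simp add: mod_eq_0_iff_dvd)
  then have "t dvd r" using assms(1) by (simp add: mult.commute)
  then obtain u where "r = t * u" ..
  with pow that show ?thesis by (simp add: mult.assoc)
qed

text \<open>The square is asked to centralize only \<open>a^t\<close>, not all of
  \<open>Cn n\<close>; this is the necessary condition extracted from a nonzero indicator.\<close>

definition square_central :: "nat \<Rightarrow> nat \<Rightarrow> (nat \<Rightarrow> nat) set"
  where "square_central n t =
    {x \<in> orbit_type n t. x \<circ> x \<circ> (cyc n ^^ t) = (cyc n ^^ t) \<circ> (x \<circ> x)}"

text \<open>The square of \<open>v x\<close> conjugates \<open>a^t\<close> to the power
  \<open>(u v)^2\<close> of itself, so \<open>u v\<close> is a root of 1 modulo \<open>m\<close>.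
  The pair of \<open>u v mod m\<close> and \<open>v div m\<close> determines
  \<open>v\<close>.\<close>

lemma card_square_central_multiples:
  assumes "2 \<le> m" "0 < t" "x \<in> orbit_type (m * t) t"
  shows "card {v \<in> totatives (m * t). mult_map (m * t) v \<circ> x \<in> square_central (m * t) t}
    \<le> card (sqrts_of_one m) * t" (is "card ?V \<le> _")
proof -
  let ?a = "cyc (m * t)"
  have n: "0 < m * t" "0 < m" using assms by auto
  obtain u where u: "\<And>k. x \<circ> (?a ^^ (t * k)) = (?a ^^ (t * (u * k))) \<circ> x"
    using orbit_type_multiplier[OF n(2) assms(2,3)] by blast
  have sq: "[(u * v) * (u * v) = 1] (mod m)" if v: "v \<in> ?V" for v
  proof -
    let ?p = "mult_map (m * t) v"
    let ?y = "?p \<circ> x"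
    have cop: "coprime v (m * t)" using v by (simp add: in_totatives_iff)
    have y: "?y \<circ> (?a ^^ (t * k)) = (?a ^^ (t * (u * v * k))) \<circ> ?y" for k
    proof -
      have "?y \<circ> (?a ^^ (t * k)) = (?p \<circ> (?a ^^ (t * (u * k)))) \<circ> x"
        using u[of k] by (simp only: comp_assoc)
      also have "\<dots> = (?a ^^ (v * (t * (u * k)))) \<circ> ?y"
        unfolding mult_map_shift[OF n(1) cop] by (simp only: comp_assoc)
      finally show ?thesis by (simp only: mult_ac)
    qed
    have "?y \<in> Sn1 (m * t)" using v by (simp add: square_central_def orbit_type_def)
    then have yp: "bij (?y \<circ> ?y)" using Sn1_iff permutes_bij bij_comp by blast
    have "?y \<circ> ?y \<circ> (?a ^^ t) = ?y \<circ> (?y \<circ> (?a ^^ (t * 1)))" by (simp only: comp_assoc mult_1_right)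
    also have "\<dots> = (?y \<circ> (?a ^^ (t * (u * v)))) \<circ> ?y"
      unfolding y[of 1] by (simp only: comp_assoc mult_1_right)
    also have "\<dots> = (?a ^^ (t * (u * v * (u * v)))) \<circ> (?y \<circ> ?y)"
      unfolding y[of "u * v"] by (rule comp_assoc)
    finally have "(?a ^^ (t * (u * v * (u * v)))) \<circ> (?y \<circ> ?y) = (?a ^^ t) \<circ> (?y \<circ> ?y)"
      using v by (simp add: square_central_def)
    then have "?a ^^ (t * (u * v * (u * v))) = ?a ^^ (t * 1)"
      using surj_comp_cancel[OF bij_is_surj[OF yp]] by simp
    then have "[t * (u * v * (u * v)) = t * 1] (mod (t * m))"
      using n by (simp only: cyc_pow_eq_iff cong_def mult.commute[of m])
    then show ?thesis using assms(2) by (simp add: cong_def mult.assoc)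
  qed
  have "inj_on (\<lambda>v. ((u * v) mod m, v div m)) ?V"
  proof (rule inj_onI)
    fix v w assume vw: "v \<in> ?V" "w \<in> ?V" "((u * v) mod m, v div m) = ((u * w) mod m, w div m)"
    \<comment> \<open>Invertibility of \<open>u\<close> modulo \<open>m\<close> is read off from the
      root equation, so \<open>u\<close> can be cancelled.\<close>
    have "coprime ((u * v) * (u * v)) m" using sq[OF vw(1)] by (metis cong_imp_coprime cong_sym coprime_1_left)
    then have "coprime u m" by simp
    moreover have "[u * v = u * w] (mod m)" using vw(3) by (simp add: cong_def)
    ultimately have "[v = w] (mod m)" by (simp add: cong_mult_lcancel_nat)
    then have "v mod m = w mod m" by (simp only: cong_def)
    moreover have "v div m = w div m" using vw(3) by (rule conjunct2[OF iffD1[OF prod.inject]])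
    ultimately show "v = w" by (metis div_mult_mod_eq)
  qed
  moreover have "(\<lambda>v. ((u * v) mod m, v div m)) ` ?V \<subseteq> sqrts_of_one m \<times> {..<t}"
  proof clarify
    fix v assume v: "v \<in> totatives (m * t)" "mult_map (m * t) v \<circ> x \<in> square_central (m * t) t"
    \<comment> \<open>Totatives of \<open>m * t\<close> range up to \<open>m * t\<close> inclusive;
      only a modulus above 1 excludes the endpoint and yields \<open>v div m < t\<close>.\<close>
    have "1 < m * t" using mult_le_mono[of 2 m 1 t] assms(1,2) by simp
    then have "v < m * t" using v(1) by (rule totatives_less[rotated])
    then have "v div m < t" using n by (simp add: div_less_iff_less_mult mult.commute)
    moreover have "(u * v) mod m \<in> sqrts_of_one m"
      using sq[of v] v n by (simp add: sqrts_of_one_def cong_def mod_simps)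
    ultimately show "(u * v) mod m \<in> sqrts_of_one m \<and> v div m \<in> {..<t}" by simp
  qed
  ultimately have "card ?V \<le> card (sqrts_of_one m \<times> {..<t})"
    by (intro card_inj_on_le) auto
  then show ?thesis by (simp add: card_cartesian_product)
qed

text \<open>Double counting of the pairs \<open>(x, v)\<close> for which \<open>v x\<close> has a square centralizing \<open>a\<^sup>t\<close>.\<close>

lemma card_square_central_bound:
  assumes "2 \<le> m" "0 < t"
  shows "card (square_central (m * t) t) * totient (m * t)
    \<le> card (orbit_type (m * t) t) * (card (sqrts_of_one m) * t)"
proof -
  let ?n = "m * t"
  let ?B = "square_central ?n t" and ?X = "orbit_type ?n t"
  let ?V = "\<lambda>x. {v \<in> totatives ?n. mult_map ?n v \<circ> x \<in> ?B}"
  have n: "0 < ?n" using assms by simp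
  have inv: "mult_map ?n v \<circ> (inv' (mult_map ?n v) \<circ> x) = x" if "v \<in> totatives ?n" for v x
  proof -
    have "mult_map ?n v \<circ> inv' (mult_map ?n v) = id"
      using mult_map_Sn1[OF n] that Sn1_iff permutes_inv_o(1) in_totatives_iff by blast
    then show ?thesis by (metis comp_assoc id_comp)
  qed
  \<comment> \<open>Applying \<open>v\<close> to \<open>v^-1 x\<close> returns \<open>x\<close>, so
    this map is injective and lands in the pairs counted by \<open>?V\<close>.\<close>
  let ?f = "\<lambda>(x, v). (inv' (mult_map ?n v) \<circ> x, v)"
  have "inj_on ?f (?B \<times> totatives ?n)"
  proof (rule inj_onI, clarify)
    fix x v y assume "v \<in> totatives ?n" "inv' (mult_map ?n v) \<circ> x = inv' (mult_map ?n v) \<circ> y"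
    then show "x = y \<and> v = v" using inv by metis
  qed
  moreover have "?f ` (?B \<times> totatives ?n) \<subseteq> Sigma ?X ?V"
  proof clarify
    fix x v assume xv: "x \<in> ?B" "v \<in> totatives ?n"
    then have "x \<in> ?X" "coprime v ?n" by (auto simp: square_central_def in_totatives_iff)
    then show "inv' (mult_map ?n v) \<circ> x \<in> ?X \<and> v \<in> ?V (inv' (mult_map ?n v) \<circ> x)"
      using mult_map_orbit_type(2)[OF n] inv[OF xv(2), of x] xv by simp
  qed
  ultimately have "card (?B \<times> totatives ?n) \<le> card (Sigma ?X ?V)"
    by (intro card_inj_on_le) auto
  also have "\<dots> = (\<Sum>x\<in>?X. card (?V x))" by simp
  also have "\<dots> \<le> (\<Sum>x\<in>?X. card (sqrts_of_one m) * t)"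
    using card_square_central_multiples[OF assms] by (rule sum_mono)
  finally show ?thesis by (simp add: card_cartesian_product totient_def)
qed

section \<open>Nonvanishing indicators\<close>

lemma J_integral_eq:
  assumes "0 < n"
  shows "J_integral n = (\<lambda>(y, b). if y = id \<and> b \<in> Cn n then 1 / of_nat (card (Cn n)) else 0)"
  unfolding J_integral_def
  by (rule the1_equality) (rule ex1_normalized_integral[OF assms], rule is_normalized_integral_explicit[OF assms])

text \<open>The integral averages the elements \<open>p_1 # b\<close>. Its coproduct has the terms
  \<open>(p_(z^-1) # (z \<rhd> b)) \<otimes> (p_z # b)\<close>, whose factors multiply to 0 unless
  \<open>z = z^-1 \<lhd> (z \<rhd> b)\<close>; here \<open>y = z^-1\<close>.\<close>

lemma integral_square_support:
  assumes "0 < n" "J_mult_tensor n (J_comult n (J_integral n)) (y, g) \<noteq> 0"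
  shows "\<exists>b\<in>Cn n. lhd n y b = inv' y"
proof -
  obtain p where p: "p \<in> J_basis n \<times> J_basis n"
    "(\<lambda>(u, v). J_comult n (J_integral n) (u, v) * J_mult_basis n u v (y, g)) p \<noteq> 0"
    by (rule sum.not_neutral_contains_not_neutral[OF assms(2)[unfolded J_mult_tensor_def]])
  obtain u v where "p = (u, v)" by (cases p)
  with p have uv: "u \<in> J_basis n" "v \<in> J_basis n" "J_comult n (J_integral n) (u, v) \<noteq> 0"
    "J_mult_basis n u v (y, g) \<noteq> 0" by (simp_all del: J_mult_basis.simps)
  obtain y1 b1 where u: "u = (y1, b1)" by fastforce
  obtain z c where v: "v = (z, c)" by fastforce
  have y: "y1 = y" "z = lhd n y b1" "b1 \<in> Cn n"
    using uv(1,4) unfolding u v by (auto simp: J_basis_def split: if_splits)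
  obtain w where "J_integral n w * J_comult_basis n w (u, v) \<noteq> 0"
    by (rule sum.not_neutral_contains_not_neutral[OF uv(3)[unfolded J_comult_def]])
  then have w: "J_integral n w \<noteq> 0" "J_comult_basis n w (u, v) \<noteq> 0"
    by (simp_all del: J_comult_basis.simps)
  obtain b where wb: "w = (id, b)" using w(1) by (cases w) (auto simp: J_integral_eq[OF assms(1)] split: if_splits)
  obtain z' where z': "z' \<in> Sn1 n"
    "(if (u, v) = ((id \<circ> inv' z', rhd n z' b), (z', b)) then 1 else 0 :: complex) \<noteq> 0"
    by (rule sum.not_neutral_contains_not_neutral[OF w(2)[unfolded wb J_comult_basis.simps]])
  then have "(u, v) = ((id \<circ> inv' z', rhd n z' b), (z', b))" by presburger
  then have "y1 = inv' z'" "z = z'" unfolding u v by simp_all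
  then have "y = inv' z" "z \<in> Sn1 n" using y(1) z'(1) by simp_all
  then have "inv' y = z" using Sn1_iff permutes_inv_inv by metis
  then show ?thesis using y(2,3) by metis
qed

text \<open>Since \<open>x b x\<close> commutes with \<open>a\<close>, the product
  \<open>x b x a\<close> equals both \<open>x a' b x\<close> and \<open>a x b x\<close>. Cancelling
  \<open>b x\<close> gives \<open>x a' = a x\<close>: conjugation by \<open>x\<close> swaps
  \<open>a\<close> and \<open>a'\<close>.\<close>

lemma commute_square:
  assumes "bij x" "x \<circ> b \<circ> x = c" "x \<circ> a = a' \<circ> x" "a' \<circ> b = b \<circ> a'" "a \<circ> c = c \<circ> a" "bij b"
  shows "x \<circ> x \<circ> a = a \<circ> (x \<circ> x)"
proof -
  have s: "surj (b \<circ> x)" using assms(1,6) bij_comp bij_is_surj by blast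
  have "(x \<circ> a') \<circ> (b \<circ> x) = x \<circ> (a' \<circ> b) \<circ> x" by (simp only: comp_assoc)
  also have "\<dots> = x \<circ> b \<circ> (a' \<circ> x)" unfolding assms(4) by (simp only: comp_assoc)
  also have "\<dots> = (x \<circ> b \<circ> x) \<circ> a" unfolding assms(3)[symmetric] by (simp only: comp_assoc)
  also have "\<dots> = a \<circ> (x \<circ> b \<circ> x)" unfolding assms(2) by (rule assms(5)[symmetric])
  also have "\<dots> = (a \<circ> x) \<circ> (b \<circ> x)" by (simp only: comp_assoc)
  finally have "(x \<circ> a') \<circ> (b \<circ> x) = (a \<circ> x) \<circ> (b \<circ> x)" .
  then have xa: "x \<circ> a' = a \<circ> x" by (rule surj_comp_cancel[OF s])
  have "x \<circ> x \<circ> a = (x \<circ> a') \<circ> x" using assms(3) by (simp only: comp_assoc)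
  then show ?thesis unfolding xa by (simp only: comp_assoc)
qed

text \<open>A nonzero summand of the trace gives \<open>y\<close> in the orbit of \<open>x\<close>,
  and the support of the squared integral puts \<open>inv' y\<close> into the orbit of
  \<open>y\<close>. Rewritten in terms of \<open>x\<close>, this says that \<open>x b' x\<close>
  lies in \<open>Cn n\<close> for some \<open>b'\<close> in \<open>Cn n\<close>.\<close>

lemma FS_indicator_nonzero:
  assumes "0 < n" "x \<in> orbit_type n t" "matrix_rep (stab_group n x) R" "FS_indicator n x R \<noteq> 0"
  shows "x \<in> square_central n t"
proof -
  obtain d \<rho> where R: "R = (d, \<rho>)" by fastforce
  let ?h = "J_mult_tensor n (J_comult n (J_integral n))"
  have x: "x \<in> Sn1 n" using assms(2) by (simp add: orbit_type_def)
  let ?S = "\<lambda>y g. \<Sum>c\<in>coset_rep n x ` Cn n. if lhd n y (g \<circ> c) = x \<and> c = coset_rep n x (g \<circ> c)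
    then \<Sum>j<d. \<rho> (inv' c \<circ> (g \<circ> c)) $$ (j, j) else 0"
  obtain p where p: "p \<in> J_basis n" "(\<lambda>(y, g). ?h (y, g) * ?S y g) p \<noteq> 0"
    by (rule sum.not_neutral_contains_not_neutral[OF assms(4)[unfolded FS_indicator_def R
      ind_char_eq[OF assms(1) x assms(3)[unfolded R]]]])
  obtain y g where "p = (y, g)" by fastforce
  with p have yg: "(y, g) \<in> J_basis n" "?h (y, g) \<noteq> 0" "?S y g \<noteq> 0" by auto
  have y: "y \<in> Sn1 n" "g \<in> Cn n" using yg(1) by (auto simp: J_basis_def)
  obtain k where k: "k \<in> coset_rep n x ` Cn n" and lk: "lhd n y (g \<circ> k) = x"
    using sum.not_neutral_contains_not_neutral[OF yg(3)] by (metis (no_types, lifting))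
  have "k \<in> Cn n" using k coset_rep_Cn[OF assms(1) x] by auto
  then have e: "g \<circ> k \<in> Cn n" using y(2) Cn_comp by blast
  define e where "e = g \<circ> k"
  define c1 where "c1 = rhd n y e"
  have 1: "y \<circ> e = c1 \<circ> x" "e \<in> Cn n" "c1 \<in> Cn n"
    using rhd_lhd[OF assms(1), of y e] lk e rhd_Cn[OF assms(1)] by (auto simp: e_def c1_def)
  obtain b where b: "b \<in> Cn n" "lhd n y b = inv' y" using integral_square_support[OF assms(1) yg(2)] by blast
  define c2 where "c2 = rhd n y b"
  have c2: "y \<circ> b = c2 \<circ> inv' y" "c2 \<in> Cn n"
    using rhd_lhd[OF assms(1), of y b] b rhd_Cn[OF assms(1)] by (auto simp: c2_def)
  note inv_e = permutes_inv_o[OF Cn_permutes[OF 1(2)]] and inv_c1 = permutes_inv_o[OF Cn_permutes[OF 1(3)]]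
  have inv_y: "inv' y \<circ> y = id" using y(1) Sn1_iff permutes_inv_o(2) by blast
  have yeq: "y = c1 \<circ> x \<circ> inv' e" using 1(1) inv_e by (metis comp_assoc comp_id)
  have "y \<circ> b \<circ> y = c2" using c2(1) inv_y by (simp add: comp_assoc)
  then have "c1 \<circ> (x \<circ> (inv' e \<circ> b \<circ> c1) \<circ> x) \<circ> inv' e = c2"
    by (simp add: yeq comp_assoc)
  then have xbx: "x \<circ> (inv' e \<circ> b \<circ> c1) \<circ> x = inv' c1 \<circ> c2 \<circ> e"
    using inv_e inv_c1 by (metis (no_types, lifting) comp_assoc comp_id id_comp)
  \<comment> \<open>Conjugation by \<open>x\<close> takes \<open>a^t\<close> to some
    \<open>a'\<close> in the abelian group \<open>Cn n\<close>, which supplies the commutations that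
    \<open>commute_square\<close> asks for.\<close>
  have "cyc n ^^ t \<in> stab n x"
    using assms(2) generate.incl[of "cyc n ^^ t" "{cyc n ^^ t}" "sym_group n"] by (simp add: orbit_type_def)
  then obtain a' where a': "cyc n ^^ t \<in> Cn n" "a' \<in> Cn n" "x \<circ> (cyc n ^^ t) = a' \<circ> x"
    using mem_stab_iff[OF assms(1) x] by blast
  have C: "inv' e \<circ> b \<circ> c1 \<in> Cn n" "inv' c1 \<circ> c2 \<circ> e \<in> Cn n"
    using 1 b c2 by (auto intro!: Cn_comp Cn_inv)
  have "x \<circ> x \<circ> (cyc n ^^ t) = (cyc n ^^ t) \<circ> (x \<circ> x)"
  proof (rule commute_square[OF _ xbx a'(3)])
    show "bij x" using x Sn1_iff permutes_bij by blast
    show "bij (inv' e \<circ> b \<circ> c1)" using C(1) Cn_permutes permutes_bij by blast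
    show "a' \<circ> (inv' e \<circ> b \<circ> c1) = (inv' e \<circ> b \<circ> c1) \<circ> a'" by (rule Cn_commute[OF assms(1) a'(2) C(1)])
    show "(cyc n ^^ t) \<circ> (inv' c1 \<circ> c2 \<circ> e) = (inv' c1 \<circ> c2 \<circ> e) \<circ> (cyc n ^^ t)"
      by (rule Cn_commute[OF assms(1) a'(1) C(2)])
  qed
  then show ?thesis using assms(2) by (simp add: square_central_def)
qed

section \<open>The ratio\<close>

lemma card_Irr_stab_pos:
  assumes "0 < n" "x \<in> orbit_type n t" shows "0 < card (Irr (stab_group n x))"
proof -
  have x: "x \<in> Sn1 n" and st: "stab n x = range (\<lambda>k. cyc n ^^ (t * k))"
    using assms by (auto simp: orbit_type_def generate_cyc_pow)
  have pow: "h [^]\<^bsub>stab_group n x\<^esub> (k::nat) = h ^^ k" for h k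
  proof (induction k)
    case (Suc k)
    then show ?case by (simp add: nat_pow_def sym_group_mult flip: funpow_Suc_right)
  qed (simp add: nat_pow_def sym_group_one)
  show ?thesis
  proof (rule card_Irr_cyclic_pos[where g = "cyc n ^^ t" and N = n])
    show "monoid (stab_group n x)"
      using subgroup.subgroup_is_group[OF stab_subgroup[OF assms(1) x] sym_group_is_group] by (simp add: group.is_monoid)
    show "finite (carrier (stab_group n x))"
      using finite_subset[OF _ finite_Cn[of n], of "stab n x"] by (auto simp: stab_def)
    show "cyc n ^^ t \<in> carrier (stab_group n x)"
      using st rangeI[of "\<lambda>k. cyc n ^^ (t * k)" 1] by simp
    have pows: "(\<lambda>k::nat. (cyc n ^^ t) [^]\<^bsub>stab_group n x\<^esub> k) = (\<lambda>k. cyc n ^^ (t * k))"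
      by (rule ext) (simp add: pow funpow_mult)
    have "carrier (stab_group n x) = range (\<lambda>k. cyc n ^^ (t * k))" using st by simp
    then show "carrier (stab_group n x) = range (\<lambda>k::nat. (cyc n ^^ t) [^]\<^bsub>stab_group n x\<^esub> k)"
      unfolding pows .
    fix h assume "h \<in> carrier (stab_group n x)"
    then obtain k where "h = cyc n ^^ k" using st by auto
    moreover have "cyc n ^^ (k * n) = cyc n ^^ 0" using assms(1) by (simp only: cyc_pow_eq_iff) simp
    ultimately show "h [^]\<^bsub>stab_group n x\<^esub> n = \<one>\<^bsub>stab_group n x\<^esub>"
      by (simp add: pow funpow_mult sym_group_one)
  qed (rule assms)
qed

text \<open>On \<open>orbit_type n t\<close> the group \<open>stab_group n x\<close> is literally
  the same, so \<open>Irr\<close> is one fixed set and its size \<open>K\<close> is a common factor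
  that cancels in the ratio.\<close>

lemma irreps_of_dim_counts:
  assumes "0 < n" "orbit_type n t \<noteq> {}"
  obtains K where "0 < K" "card (irreps_of_dim n t) = card (orbit_type n t) * K"
    "card (irreps_of_dim_indicator_one n t) \<le> card (square_central n t) * K"
proof -
  define I where "I = (Irr (sym_group n \<lparr>carrier := generate (sym_group n) {cyc n ^^ t}\<rparr>) ::
    (nat \<Rightarrow> nat) mrep set set)"
  have I: "Irr (stab_group n x) = I" if "x \<in> orbit_type n t" for x
    using that by (simp add: orbit_type_def I_def)
  obtain x0 where "x0 \<in> orbit_type n t" using assms(2) by blast
  then have K: "0 < card I" using card_Irr_stab_pos[OF assms(1)] I by metis
  then have fin: "finite I" by (rule card_ge_0_finite)
  have "irreps_of_dim n t = orbit_type n t \<times> I"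
    using I by (auto simp: irreps_of_dim_def orbit_type_def)
  moreover have "irreps_of_dim_indicator_one n t \<subseteq> square_central n t \<times> I"
  proof clarify
    fix x V assume "(x, V) \<in> irreps_of_dim_indicator_one n t"
    then obtain R where xV: "(x, V) \<in> irreps_of_dim n t" "R \<in> V" "FS_indicator n x R = 1"
      by (auto simp: irreps_of_dim_indicator_one_def)
    then have x: "x \<in> orbit_type n t" and V: "V \<in> Irr (stab_group n x)"
      by (auto simp: irreps_of_dim_def orbit_type_def)
    \<comment> \<open>Any representative of the class is itself a representation, as the
      nonvanishing criterion requires.\<close>
    have "V \<subseteq> {R. irreducible_rep (stab_group n x) R}"
      using V unfolding Irr_def by (rule in_quotient_imp_subset[OF equiv_rep_iso])
    then have "irreducible_rep (stab_group n x) R" using xV(2) by blast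
    then have "matrix_rep (stab_group n x) R" by (cases R) (simp del: matrix_rep.simps)
    then show "x \<in> square_central n t \<and> V \<in> I"
      using FS_indicator_nonzero[OF assms(1) x] xV(3) V I[OF x] by simp
  qed
  then have "card (irreps_of_dim_indicator_one n t) \<le> card (square_central n t \<times> I)"
    using fin finite_subset[of "square_central n t" "orbit_type n t"]
    by (intro card_mono) (auto simp: square_central_def)
  ultimately show ?thesis using that[OF K] by (simp add: card_cartesian_product)
qed

theorem theorem7p4:
  fixes t :: nat
  assumes "odd t"
  shows "(\<forall>\<^sub>F m in sequentially. card (irreps_of_dim (m * t) t) \<noteq> 0) \<and>
    (\<lambda>m. real (card (irreps_of_dim_indicator_one (m * t) t)) / real (card (irreps_of_dim (m * t) t)))
      \<longlonglongrightarrow> 0"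
proof
  have t: "0 < t" using assms by (rule odd_pos)
  let ?ratio = "\<lambda>m. real (card (irreps_of_dim_indicator_one (m * t) t)) / real (card (irreps_of_dim (m * t) t))"
  have main: "card (irreps_of_dim (m * t) t) \<noteq> 0 \<and>
      ?ratio m \<le> real t * (real (card (sqrts_of_one m)) / real (totient m))" if m: "3 \<le> m" for m
  proof -
    let ?n = "m * t"
    let ?X = "card (orbit_type ?n t)" and ?B = "card (square_central ?n t)"
    have n: "0 < ?n" using t m by simp
    have ne: "orbit_type ?n t \<noteq> {}" by (rule orbit_type_nonempty[OF t m])
    then have X: "0 < ?X" by (simp add: card_gt_0_iff)
    obtain K where K: "0 < K" "card (irreps_of_dim ?n t) = ?X * K"
      "card (irreps_of_dim_indicator_one ?n t) \<le> ?B * K"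
      by (rule irreps_of_dim_counts[OF n ne])
    have "?ratio m \<le> real (?B * K) / real (?X * K)"
      unfolding K(2) using K(3) by (intro divide_right_mono) (simp_all only: of_nat_le_iff of_nat_0_le_iff)
    also have "\<dots> = real ?B / real ?X" using K(1) by simp
    also have "\<dots> \<le> real (card (sqrts_of_one m) * t) / real (totient ?n)"
    proof -
      have "real (?B * totient ?n) \<le> real (?X * (card (sqrts_of_one m) * t))"
        using card_square_central_bound[of m t] m t by (intro of_nat_mono) simp
      then show ?thesis using X n by (simp add: divide_simps mult_ac)
    qed
    \<comment> \<open>As \<open>m\<close> divides \<open>m t\<close>,
      \<open>\<phi>(m) \<le> \<phi>(m t)\<close>; apart from the constant \<open>t\<close> the bound
      then depends on \<open>m\<close> alone.\<close>
    also have "\<dots> \<le> real (card (sqrts_of_one m) * t) / real (totient m)"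
      using totient_dvd_mono[of m ?n] n m by (intro divide_left_mono) auto
    finally show ?thesis using K X ne by (simp add: mult.commute)
  qed
  then show "\<forall>\<^sub>F m in sequentially. card (irreps_of_dim (m * t) t) \<noteq> 0"
    by (intro eventually_sequentiallyI[of 3]) blast
  show "?ratio \<longlonglongrightarrow> 0"
  proof (rule tendsto_sandwich[of "\<lambda>_. 0"])
    show "\<forall>\<^sub>F m in sequentially. ?ratio m \<le> real t * (real (card (sqrts_of_one m)) / real (totient m))"
      using main by (intro eventually_sequentiallyI[of 3]) blast
    show "(\<lambda>m. real t * (real (card (sqrts_of_one m)) / real (totient m))) \<longlonglongrightarrow> 0"
      using tendsto_mult_right_zero[OF sqrts_of_one_totient_ratio] .
  qed auto
qed

end
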